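(* For any positive constants $\alpha_1,\alpha_2$ and any constant positive integer $k$ there is a positive constant $C=C(\alpha_1,\alpha_2,k)$ such that the following holds. Let $A$ be an $n\times n$ real (deterministic) matrix with $n>k$ and singular values $\sigma_1\ge\sigma_2\ge\dots\ge\sigma_n\ge0$, put $\delta_i:=\sigma_i-\sigma_{i+1}$ and assume $\delta_1,\dots,\delta_k>0$. Assume that $A$ has rank $r\le n^{1-\alpha_1}$ and that $\sigma_1\le n^{\alpha_2}$. Let $E$ be an $n\times n$ random Bernoulli matrix. Let $v_1,\dots,v_k$ and $v_1',\dots,v_k'$ be the first $k$ unit singular vectors of $A$ and of $A+E$, respectively, and set $$\varepsilon_i:=\sin\angle(v_i,v_i')\quad(1\le i\le k),\qquad s_{k-1}:=(\varepsilon_1^2+\dots+\varepsilon_{k-1}^2)^{1/2}$$ (with $s_0=0$). Then with probability $1-o(1)$ $$\varepsilon_k^2\le C\max\Big(\frac{\sqrt{r\log n}}{\delta_k},\ \frac{n}{\sigma_k\delta_k},\ \frac{\sqrt n}{\sigma_k},\ \frac{\sigma_1^2s_{k-1}^2}{\sigma_k\delta_k},\ \frac{(\sigma_1+\sqrt n)(\sigma_k+\sqrt n)\,s_{k-1}}{\sigma_k\delta_k}\Big).$$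
   Context: A random Bernoulli matrix of size $n$ is an $n\times n$ matrix whose entries are iid random variables taking values $+1$ and $-1$ with probability $1/2$ each. For a square matrix $M$ with singular values $\sigma_1(M)\ge\dots\ge\sigma_n(M)$, the corresponding unit singular vectors are the right singular vectors, i.e. an orthonormal basis of eigenvectors of $M^{*}M$ with eigenvalues $\sigma_i(M)^2$, the $i$-th one corresponding to $\sigma_i(M)$. For unit vectors $v,v'$, $\angle(v,v')$ is the angle between them taken in $[0,\pi/2]$ (so the sign ambiguity of singular vectors is irrelevant), i.e. $\sin^2\angle(v,v')=1-(v\cdot v')^2$. Asymptotic notation is as $n\to\infty$; "with probability $1-o(1)$" means that the probability of the event is at least $1-p_n$ for some sequence $p_n\to0$ depending only on the constants of the statement ($\alpha_1,\alpha_2,k$) and not on the particular matrix $A=A_n$. *)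

theory Defs
  imports
    "HOL-Probability.Probability"
    "HOL-Probability.Product_PMF"
    "Jordan_Normal_Form.Char_Poly"
    "Jordan_Normal_Form.DL_Rank"
begin

unbundle no inner_syntax

text \<open>
  The law of the $n \times n$ matrix with independent entries, each uniform on $\{-1,1\}$.
  (The second argument of \<^const>\<open>Pi_pmf\<close> is only the default value outside the index set.)
\<close>

definition bernoulli_matrix_pmf :: "nat \<Rightarrow> real mat pmf" where
  "bernoulli_matrix_pmf n =
     map_pmf (Matrix.mat n n)
       (Pi_pmf ({0..<n} \<times> {0..<n}) 0 (\<lambda>_. pmf_of_set {-1, 1}))"

text \<open>
  With $n$ the number of columns of $M$: the numbers $\sigma_1 \ge \dots \ge \sigma_n \ge 0$ are
  the singular values of $M$ and $v_1, \dots, v_n$ are corresponding unit (right) singular vectors,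
  an orthonormal basis. Indices start at 1; the values of \<open>\<sigma>\<close> and \<open>v\<close> outside
  $\{1,\dots,n\}$ are irrelevant. \<open>M\<close> determines $\sigma_1,\dots,\sigma_n$,
  but \<open>v\<close> only up to the usual ambiguity (signs, and the choice of basis in
  multiple eigenspaces), so this is a relation.
\<close>

definition right_singular_system :: "real mat \<Rightarrow> (nat \<Rightarrow> real) \<Rightarrow> (nat \<Rightarrow> real vec) \<Rightarrow> bool" where
  "right_singular_system M \<sigma> v \<longleftrightarrow>
     (\<forall>i\<in>{1..dim_col M}. 0 \<le> \<sigma> i) \<and>
     (\<forall>i\<in>{1..dim_col M}. \<forall>j\<in>{1..dim_col M}. i \<le> j \<longrightarrow> \<sigma> j \<le> \<sigma> i) \<and>
     (\<forall>i\<in>{1..dim_col M}. eigenvector (transpose_mat M * M) (v i) ((\<sigma> i)\<^sup>2)) \<and>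
     (\<forall>i\<in>{1..dim_col M}. \<forall>j\<in>{1..dim_col M}. v i \<bullet> v j = (if i = j then 1 else 0))"

text \<open>The angle between the lines spanned by two nonzero vectors, in $[0,\pi/2]$.\<close>

definition line_angle :: "real vec \<Rightarrow> real vec \<Rightarrow> real" where
  "line_angle u w = arccos (\<bar>u \<bullet> w\<bar> / (sqrt (u \<bullet> u) * sqrt (w \<bullet> w)))"

end

theory Submission
  imports Defs
begin

text \<open>
  Let $x = v_k'$ and expand $x = \sum c_i v_i$. Orthogonality of the $v_i'$ gives
  $\sum_{i<k} c_i^2 \le s_{k-1}^2$, so that
  $\|Ax\|^2 \le \sigma_1^2 s_{k-1}^2 + \sigma_k^2 - (\sigma_k^2 - \sigma_{k+1}^2) \varepsilon_k^2$.
  Comparing $\|(A+E)x\|^2 = \sigma_k'^2$ with the Courant-Fischer bound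
  $\sigma_k' \ge \sigma_k - T$ yields the estimate, once the cross term $Ax \cdot Ex$ is under
  control. For this one needs only two norms: $\|E\| = O(\sqrt n)$, and
  $T = O(\sqrt{r \log n})$ for the compression of $E$ to the column and row spaces of $A$. The
  component of $x$ outside the row space of $A$ has norm at most $\|E\| / \sigma_k'$, because
  $A$ annihilates it. Both norms are bounded by Hoeffding's inequality and a union bound over a
  lattice net of the unit ball.
\<close>

subsection \<open>Norms of compressions of a Bernoulli matrix\<close>

text \<open>The cross term is the obstacle. Estimating it by \<open>\<sigma> k\<close> times the
  operator norm of \<open>E\<close> would cost \<open>sqrt n / \<delta> k\<close>, while only
  \<open>sqrt (r * ln n) / \<delta> k\<close> is allowed. Moreover \<open>x\<close> depends on
  \<open>E\<close>, so a tail bound for fixed vectors does not apply and the control must be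
  uniform. Both difficulties disappear if \<open>E\<close> is seen through the bilinear form that it
  induces between the left and right singular vectors of \<open>A\<close> with positive singular
  value: these are fixed before \<open>E\<close> is drawn and number at most \<open>r\<close>, so a
  net of size exponential in \<open>r\<close> suffices. The logarithm is not for the net; it makes
  the failure probability tend to 0 even when \<open>r\<close> stays bounded. The kernel component
  of \<open>x\<close>, which this form does not see, pays the operator norm twice, once for its own
  size and once for the action of \<open>E\<close> on it. The factor \<open>\<sigma> k\<close>
  cancels, so it contributes \<open>O(n)\<close>, that is
  \<open>n / (\<sigma> k * \<delta> k)\<close> after division by
  \<open>\<sigma> k * \<delta> k\<close>, a lower bound for the difference of the squares of
  \<open>\<sigma> k\<close> and \<open>\<sigma> (k + 1)\<close>.\<close>

lemma expectation_rademacher_component: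
  assumes "finite J" "j \<in> J"
  shows "measure_pmf.expectation (Pi_pmf J 0 (\<lambda>_. pmf_of_set {-1, 1 :: real})) (\<lambda>f. c * f j) = 0"
proof -
  have "measure_pmf.expectation (Pi_pmf J 0 (\<lambda>_. pmf_of_set {-1, 1 :: real})) (\<lambda>f. c * f j)
      = measure_pmf.expectation (map_pmf (\<lambda>f. f j) (Pi_pmf J 0 (\<lambda>_. pmf_of_set {-1, 1 :: real}))) (\<lambda>x. c * x)"
    by simp
  also have "map_pmf (\<lambda>f. f j) (Pi_pmf J 0 (\<lambda>_. pmf_of_set {-1, 1 :: real})) = pmf_of_set {-1, 1}"
    using assms by (simp add: Pi_pmf_component)
  also have "measure_pmf.expectation (pmf_of_set {-1, 1 :: real}) (\<lambda>x. c * x) = 0"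
    by (subst integral_pmf_of_set) auto
  finally show ?thesis .
qed

text \<open>Hoeffding's inequality for the independent centred terms \<open>c j * f j\<close>, which
  lie in intervals of width \<open>2 * \<bar>c j\<bar>\<close>. The squared widths add up to at most
  4, whence the exponent \<open>- t\<^sup>2 / 2\<close>.\<close>

lemma rademacher_sum_tail:
  fixes c :: "'i \<Rightarrow> real"
  assumes J: "finite J" and c: "(\<Sum>j\<in>J. (c j)\<^sup>2) \<le> 1" and t: "t > 0"
  shows "measure_pmf.prob (Pi_pmf J 0 (\<lambda>_. pmf_of_set {-1, 1})) {f. t \<le> \<bar>\<Sum>j\<in>J. c j * f j\<bar>}
           \<le> 2 * exp (- t\<^sup>2 / 2)"
\<comment> \<open>Hoeffding's inequality needs a positive total width. If all coefficients vanish,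
  the event is empty because \<open>t > 0\<close>.\<close>
proof (cases "(\<Sum>j\<in>J. (c j)\<^sup>2) = 0")
  case True
  then have "c j = 0" if "j \<in> J" for j
    using that J by (simp add: sum_nonneg_eq_0_iff)
  then have "{f. t \<le> \<bar>\<Sum>j\<in>J. c j * f j\<bar>} = {}"
    using t by auto
  then show ?thesis by simp
next
  case False
  define P where "P = Pi_pmf J 0 (\<lambda>_. pmf_of_set {-1, 1 :: real})"
  define s where "s = (\<Sum>j\<in>J. (c j)\<^sup>2)"
  have s: "0 < s" "s \<le> 1"
    using False c by (auto simp: s_def sum_nonneg less_le)
  have indep: "prob_space.indep_vars (measure_pmf P) (\<lambda>_. borel) (\<lambda>j f. c j * f j) J"
    unfolding P_def
    by (rule prob_space.indep_vars_compose2[OF measure_pmf.prob_space_axioms indep_vars_Pi_pmf[OF J],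
          where Y = "\<lambda>j x. c j * x"]) simp
  have "f j \<in> {-1, 1}" if "f \<in> set_pmf P" "j \<in> J" for f j
    using that J unfolding P_def by (auto simp: set_Pi_pmf PiE_dflt_def)
  then have bnd: "AE f in measure_pmf P. c j * f j \<in> {- \<bar>c j\<bar>..\<bar>c j\<bar>}" if "j \<in> J" for j
    using that by (force simp: AE_measure_pmf_iff)
  interpret H: Hoeffding_ineq "measure_pmf P" J "\<lambda>j f. c j * f j" "\<lambda>j. - \<bar>c j\<bar>" "\<lambda>j. \<bar>c j\<bar>" 0
  proof -
    have "indep_interval_bounded_random_variables (measure_pmf P) J (\<lambda>j f. c j * f j) (\<lambda>j. - \<bar>c j\<bar>) (\<lambda>j. \<bar>c j\<bar>)"
      by unfold_locales (use J indep bnd in auto)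
    then show "Hoeffding_ineq (measure_pmf P) J (\<lambda>j f. c j * f j) (\<lambda>j. - \<bar>c j\<bar>) (\<lambda>j. \<bar>c j\<bar>)"
      by (simp add: Hoeffding_ineq_def)
    have "(\<Sum>i\<in>J. measure_pmf.expectation P (\<lambda>f. c i * f i)) = 0"
      unfolding P_def using J by (intro sum.neutral ballI expectation_rademacher_component)
    then show "0 \<equiv> \<Sum>i\<in>J. measure_pmf.expectation P (\<lambda>f. c i * f i)"
      by simp
  qed
  have width: "(\<Sum>j\<in>J. (\<bar>c j\<bar> - - \<bar>c j\<bar>)\<^sup>2) = 4 * s"
    by (simp add: s_def sum_distrib_left power2_eq_square)
  have "measure_pmf.prob P {f. t \<le> \<bar>\<Sum>j\<in>J. c j * f j\<bar>} \<le> 2 * exp (- 2 * t\<^sup>2 / (4 * s))"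
    using H.Hoeffding_ineq_abs_ge[of t] t s unfolding width by simp
  also have "- 2 * t\<^sup>2 / (4 * s) \<le> - t\<^sup>2 / 2"
    using s mult_left_mono[of s 1 "t\<^sup>2"] by (simp add: field_simps)
  then have "2 * exp (- 2 * t\<^sup>2 / (4 * s)) \<le> 2 * exp (- t\<^sup>2 / 2)"
    by simp
  finally show ?thesis unfolding P_def .
qed

section \<open>A lattice net of the unit ball and its cardinality\<close>

text \<open>With \<open>m = card J\<close>, these are the points of the unit ball lying on the
  lattice of mesh \<open>1 / (4 * sqrt m)\<close>, scaled up to integer coordinates. Cells of that
  mesh have diagonal 1/4. \<open>PiE\<close> fixes the values outside \<open>J\<close>, so that the
  set is finite.\<close>

definition int_grid :: "'i set \<Rightarrow> ('i \<Rightarrow> int) set" where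
  "int_grid J = {z \<in> PiE J (\<lambda>_. UNIV). (\<Sum>j\<in>J. (z j)\<^sup>2) \<le> 16 * int (card J)}"

text \<open>The subtracted term is what makes the induction close; afterwards only the uniform bound
  3 matters.\<close>

lemma sum_half_power_abs: "(\<Sum>z\<in>{- int N..int N}. (1/2 :: real) ^ nat \<bar>z\<bar>) \<le> 3 - 2 * (1/2) ^ N"
proof (induction N)
  case (Suc N)
  have "{- int (Suc N)..int (Suc N)} = {- int N..int N} \<union> {- int (Suc N), int (Suc N)}"
    by auto
  also have "(\<Sum>z\<in>\<dots>. (1/2 :: real) ^ nat \<bar>z\<bar>)
      = (\<Sum>z\<in>{- int N..int N}. (1/2 :: real) ^ nat \<bar>z\<bar>)
        + (\<Sum>z\<in>{- int (Suc N), int (Suc N)}. (1/2) ^ nat \<bar>z\<bar>)"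
    by (rule sum.union_disjoint) auto
  also have "(\<Sum>z\<in>{- int (Suc N), int (Suc N)}. (1/2 :: real) ^ nat \<bar>z\<bar>) = 2 * (1/2) ^ Suc N"
  proof -
    have "nat \<bar>- int (Suc N)\<bar> = Suc N" "nat \<bar>int (Suc N)\<bar> = Suc N" by linarith+
    then show ?thesis by (subst sum.insert) (auto simp del: of_nat_Suc)
  qed
  finally show ?case using Suc by simp
qed simp

text \<open>Each point of the grid has weight \<open>2 ^ (16 * m) * (\<Prod>j. 2 ^ - \<bar>z j\<bar>) \<ge> 1\<close>, and the total
  weight of the integer lattice is a product of geometric series.\<close>

lemma int_grid_count:
  assumes J: "finite J"
  shows "finite (int_grid J)" "real (card (int_grid J)) \<le> 2 ^ (18 * card J)"
proof -
  define m where "m = card J"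
  define M where "M = 16 * m"
  define box where "box = PiE J (\<lambda>_. {- int M..int M})"
  define wt :: "('a \<Rightarrow> int) \<Rightarrow> real" where "wt z = 2 ^ M * (\<Prod>j\<in>J. (1/2) ^ nat \<bar>z j\<bar>)" for z
  have fin: "finite box"
    unfolding box_def using J by (intro finite_PiE) auto
  \<comment> \<open>Integrality turns the bound on the sum of squares into the same bound
    \<open>16 * m\<close> on the sum of absolute values, which is the exponent in the weight of a
    grid point.\<close>
  have sq: "\<bar>x\<bar> \<le> x\<^sup>2" for x :: int
    by (metis abs_ge_zero abs_mult_self_eq linorder_not_le mult_le_cancel_left1 power2_eq_square
        zero_less_abs_iff abs_0 order.refl mult_zero_left int_one_le_iff_zero_less)
  have l1: "(\<Sum>j\<in>J. \<bar>z j\<bar>) \<le> int M" if "z \<in> int_grid J" for z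
  proof -
    have "(\<Sum>j\<in>J. \<bar>z j\<bar>) \<le> (\<Sum>j\<in>J. (z j)\<^sup>2)" by (intro sum_mono sq)
    then show ?thesis using that by (simp add: int_grid_def M_def m_def)
  qed
  have sub: "int_grid J \<subseteq> box"
  proof
    fix z assume z: "z \<in> int_grid J"
    have "\<bar>z j\<bar> \<le> int M" if "j \<in> J" for j
      using member_le_sum[of j J "\<lambda>j. \<bar>z j\<bar>"] that J l1[OF z] by simp
    then show "z \<in> box"
      using z unfolding box_def int_grid_def by (force simp: PiE_def Pi_def)
  qed
  show "finite (int_grid J)" using sub fin by (rule finite_subset)
  have wt: "1 \<le> wt z" if "z \<in> int_grid J" for z
  proof -
    have "(\<Sum>j\<in>J. nat \<bar>z j\<bar>) \<le> M" 
    proof -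
      have "int (\<Sum>j\<in>J. nat \<bar>z j\<bar>) = (\<Sum>j\<in>J. \<bar>z j\<bar>)" by simp
      then show ?thesis using l1[OF that] by linarith
    qed
    then have "(1/2 :: real) ^ M \<le> (1/2) ^ (\<Sum>j\<in>J. nat \<bar>z j\<bar>)"
      by (intro power_decreasing) auto
    also have "\<dots> = (\<Prod>j\<in>J. (1/2) ^ nat \<bar>z j\<bar>)" by (simp add: power_sum)
    finally have "2 ^ M * (1/2 :: real) ^ M \<le> wt z" unfolding wt_def by simp
    then show ?thesis by (simp flip: power_mult_distrib)
  qed
  have "real (card (int_grid J)) \<le> (\<Sum>z\<in>int_grid J. wt z)"
    using sum_mono[of "int_grid J" "\<lambda>_. 1" wt] wt by simp
  also have "\<dots> \<le> (\<Sum>z\<in>box. wt z)"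
    using sub fin by (intro sum_mono2) (auto simp: wt_def intro!: mult_nonneg_nonneg prod_nonneg)
  also have "\<dots> = 2 ^ M * (\<Prod>j\<in>J. \<Sum>z\<in>{- int M..int M}. (1/2) ^ nat \<bar>z\<bar>)"
    unfolding wt_def box_def sum_distrib_left[symmetric] using J by (subst prod_sum_PiE) auto
  \<comment> \<open>Each geometric sum is at most 3, rounded up to \<open>2 ^ 2\<close>; with the
    factor \<open>2 ^ (16 * m)\<close> this gives the exponent \<open>18 * m\<close>.\<close>
  also have "\<dots> \<le> 2 ^ M * (\<Prod>j\<in>J. 2 ^ 2)"
  proof (intro mult_left_mono prod_mono conjI)
    have "(\<Sum>z\<in>{- int M..int M}. (1/2 :: real) ^ nat \<bar>z\<bar>) \<le> 3"
      by (rule order.trans[OF sum_half_power_abs]) simp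
    then show "(\<Sum>z\<in>{- int M..int M}. (1/2 :: real) ^ nat \<bar>z\<bar>) \<le> 2 ^ 2" by simp
  qed (auto intro!: sum_nonneg)
  also have "\<dots> = 2 ^ (18 * card J)"
  proof -
    have "18 * m = M + 2 * m" by (simp add: M_def)
    then show ?thesis by (simp only: prod_constant power_mult[symmetric] power_add m_def)
  qed
  finally show "real (card (int_grid J)) \<le> 2 ^ (18 * card J)" .
qed

section \<open>Bilinear forms on unit balls and their control on the net\<close>

text \<open>Stated over an abstract index set so that it covers both uses: all coordinates, giving
  the operator norm of \<open>E\<close>, and the indices of positive singular values, giving its
  compression.\<close>

definition bilin :: "'i set \<Rightarrow> ('i \<Rightarrow> 'i \<Rightarrow> real) \<Rightarrow> ('i \<Rightarrow> real) \<Rightarrow> ('i \<Rightarrow> real) \<Rightarrow> real" where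
  "bilin J W a b = (\<Sum>i\<in>J. \<Sum>j\<in>J. a i * b j * W i j)"

lemma bilin_diff_left: "bilin J W (\<lambda>i. a i - a' i) b = bilin J W a b - bilin J W a' b"
  and bilin_diff_right: "bilin J W a (\<lambda>i. b i - b' i) = bilin J W a b - bilin J W a b'"
  by (simp_all add: bilin_def algebra_simps sum_subtractf)

lemma bilin_scale: "bilin J W (\<lambda>i. s * a i) (\<lambda>i. t * b i) = s * t * bilin J W a b"
  by (simp add: bilin_def sum_distrib_left algebra_simps)

lemma L2_set_scale: "L2_set (\<lambda>i. s * a i) J = \<bar>s\<bar> * L2_set a J"
  by (simp add: L2_set_def power_mult_distrib real_sqrt_mult flip: sum_distrib_left)

lemma abs_le_L2_set: "finite J \<Longrightarrow> i \<in> J \<Longrightarrow> \<bar>a i\<bar> \<le> L2_set a J"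
  using member_le_L2_set[of J i "\<lambda>i. \<bar>a i\<bar>"] by (simp add: L2_set_def)

text \<open>Rounding towards zero costs at most a quarter of the supremum \<open>S\<close> of the form over the unit
  balls in each argument, so \<open>S \<le> t + S / 2\<close>.\<close>

lemma bilin_le_grid:
  assumes J: "finite J"
    and grid: "\<And>z w. z \<in> int_grid J \<Longrightarrow> w \<in> int_grid J \<Longrightarrow>
      \<bar>bilin J W (\<lambda>i. real_of_int (z i) / (4 * sqrt (real (card J))))
        (\<lambda>i. real_of_int (w i) / (4 * sqrt (real (card J))))\<bar> \<le> t"
  shows "\<bar>bilin J W a b\<bar> \<le> 2 * t * L2_set a J * L2_set b J"
proof (cases "J = {}")
  case True
  then show ?thesis by (simp add: bilin_def)
next
  case False
  define q where "q = 4 * sqrt (real (card J))"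
  have m: "card J > 0" using False J by (simp add: card_gt_0_iff)
  have q: "q > 0" using m by (simp add: q_def)
  have qq: "q * q = 16 * real (card J)" by (simp add: q_def)
  \<comment> \<open>Rounding towards zero never increases an absolute value, so the rounded vector
    stays in the unit ball and hence in the grid. Rounding always downwards could leave the
    ball.\<close>
  define R :: "('a \<Rightarrow> real) \<Rightarrow> 'a \<Rightarrow> int" where
    "R a = restrict (\<lambda>i. if a i \<ge> 0 then \<lfloor>q * a i\<rfloor> else \<lceil>q * a i\<rceil>) J" for a
  define V where "V = {\<bar>bilin J W a b\<bar> |a b. L2_set a J \<le> 1 \<and> L2_set b J \<le> 1}"
  \<comment> \<open>A crude bound by the sum of all entries. It serves only to make the supremum
    finite, without which \<open>S \<le> t + S / 2\<close> would say nothing.\<close>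
  have unit: "\<bar>bilin J W a b\<bar> \<le> (\<Sum>i\<in>J. \<Sum>j\<in>J. \<bar>W i j\<bar>)" if "L2_set a J \<le> 1" "L2_set b J \<le> 1" for a b
  proof -
    have "\<bar>bilin J W a b\<bar> \<le> (\<Sum>i\<in>J. \<Sum>j\<in>J. \<bar>a i * b j * W i j\<bar>)"
      unfolding bilin_def by (rule order.trans[OF sum_abs]) (intro sum_mono sum_abs)
    also have "\<dots> \<le> (\<Sum>i\<in>J. \<Sum>j\<in>J. \<bar>W i j\<bar>)"
    proof (intro sum_mono)
      fix i j assume "i \<in> J" "j \<in> J"
      then have "\<bar>a i\<bar> \<le> 1" "\<bar>b j\<bar> \<le> 1"
        using abs_le_L2_set[OF J] that order.trans by blast+
      then have "\<bar>a i\<bar> * \<bar>b j\<bar> \<le> 1" by (simp add: mult_le_one)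
      then show "\<bar>a i * b j * W i j\<bar> \<le> \<bar>W i j\<bar>"
        using mult_right_mono[of "\<bar>a i\<bar> * \<bar>b j\<bar>" 1 "\<bar>W i j\<bar>"] by (simp add: abs_mult)
    qed
    finally show ?thesis .
  qed
  have bdd: "bdd_above V" unfolding V_def bdd_above_def using unit by blast
  have Vne: "V \<noteq> {}"
    unfolding V_def using L2_set_constant[of 0 J] by (auto intro!: exI[of _ "\<lambda>_. 0"] simp: L2_set_def)
  define S where "S = Sup V"
  have le_S: "\<bar>bilin J W a b\<bar> \<le> S" if "L2_set a J \<le> 1" "L2_set b J \<le> 1" for a b
    unfolding S_def by (rule cSup_upper[OF _ bdd]) (use that in \<open>auto simp: V_def\<close>)
  have hom: "\<bar>bilin J W a b\<bar> \<le> S * L2_set a J * L2_set b J" for a b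
  proof (cases "L2_set a J = 0 \<or> L2_set b J = 0")
    case True
    then have "(\<forall>i\<in>J. a i = 0) \<or> (\<forall>i\<in>J. b i = 0)"
      using J by (auto simp: L2_set_eq_0_iff)
    then have "bilin J W a b = 0" unfolding bilin_def by (auto intro!: sum.neutral)
    then show ?thesis using True by auto
  next
    case False
    then have pos: "L2_set a J > 0" "L2_set b J > 0" by (auto simp: less_le)
    let ?s = "inverse (L2_set a J)" and ?t = "inverse (L2_set b J)"
    have "\<bar>bilin J W (\<lambda>i. ?s * a i) (\<lambda>i. ?t * b i)\<bar> \<le> S"
      by (rule le_S) (use pos in \<open>simp_all add: L2_set_scale\<close>)
    then have "inverse (L2_set a J * L2_set b J) * \<bar>bilin J W a b\<bar> \<le> S"
      using pos by (simp only: bilin_scale abs_mult) simp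
    then show ?thesis using pos by (simp add: field_simps)
  qed
  have R: "R a \<in> int_grid J" "L2_set (\<lambda>i. real_of_int (R a i) / q) J \<le> 1"
    "L2_set (\<lambda>i. a i - real_of_int (R a i) / q) J \<le> 1/4" if a: "L2_set a J \<le> 1" for a
  proof -
    have *: "\<bar>real_of_int (R a i)\<bar> \<le> q * \<bar>a i\<bar>" "\<bar>q * a i - real_of_int (R a i)\<bar> \<le> 1" if "i \<in> J" for i
    proof -
      show "\<bar>q * a i - real_of_int (R a i)\<bar> \<le> 1"
        using that unfolding R_def by (auto; linarith)
      show "\<bar>real_of_int (R a i)\<bar> \<le> q * \<bar>a i\<bar>"
      proof (cases "a i \<ge> 0")
        case True
        then have "q * a i \<ge> 0" using q by simp
        then show ?thesis using True that unfolding R_def by (auto; linarith)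
      next
        case False
        then have "q * a i < 0" using q by (simp add: mult_pos_neg)
        moreover have "R a i = \<lceil>q * a i\<rceil>" using False that by (simp add: R_def)
        moreover have "\<lceil>q * a i\<rceil> \<le> 0" using \<open>q * a i < 0\<close> by linarith
        moreover have "q * a i \<le> real_of_int \<lceil>q * a i\<rceil>" by (rule le_of_int_ceiling)
        ultimately have "\<bar>real_of_int (R a i)\<bar> \<le> - (q * a i)" by simp
        then show ?thesis using False by simp
      qed
    qed
    have round: "\<bar>real_of_int (R a i) / q\<bar> \<le> \<bar>a i\<bar>" "\<bar>a i - real_of_int (R a i) / q\<bar> \<le> 1 / q" if "i \<in> J" for i
    proof -
      show "\<bar>real_of_int (R a i) / q\<bar> \<le> \<bar>a i\<bar>"
        using *(1)[OF that] q by (simp add: abs_divide divide_simps mult.commute)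
      have "a i - real_of_int (R a i) / q = (q * a i - real_of_int (R a i)) / q"
        using q by (simp add: field_simps)
      then show "\<bar>a i - real_of_int (R a i) / q\<bar> \<le> 1 / q"
        using *(2)[OF that] q by (simp add: divide_right_mono)
    qed
    have "(\<Sum>i\<in>J. (real_of_int (R a i) / q)\<^sup>2) \<le> (\<Sum>i\<in>J. (a i)\<^sup>2)"
      using round by (intro sum_mono) (metis abs_le_square_iff)
    also have "\<dots> \<le> 1" using a unfolding L2_set_def by simp
    finally have sq: "(\<Sum>i\<in>J. (real_of_int (R a i) / q)\<^sup>2) \<le> 1" .
    then show "L2_set (\<lambda>i. real_of_int (R a i) / q) J \<le> 1" unfolding L2_set_def by simp
    have "real_of_int (\<Sum>i\<in>J. (R a i)\<^sup>2) = q * q * (\<Sum>i\<in>J. (real_of_int (R a i) / q)\<^sup>2)"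
      using q by (simp add: power_divide sum_distrib_left power2_eq_square)
    also have "\<dots> \<le> q * q" using sq q by (simp add: mult_left_le)
    also have "\<dots> = real_of_int (16 * int (card J))" by (simp add: qq)
    finally show "R a \<in> int_grid J" unfolding int_grid_def
      by (simp only: of_int_le_iff) (simp add: R_def)
    \<comment> \<open>Every coordinate moves by at most \<open>1/q\<close>, and
      \<open>card J / (q * q) = 1/16\<close>: this is why \<open>q\<close> carries the factor
      4.\<close>
    have "(\<Sum>i\<in>J. (a i - real_of_int (R a i) / q)\<^sup>2) \<le> (\<Sum>i\<in>J. (1/q)\<^sup>2)"
    proof (intro sum_mono)
      fix i assume "i \<in> J"
      then show "(a i - real_of_int (R a i) / q)\<^sup>2 \<le> (1/q)\<^sup>2"
        using round(2) q power_mono[of "\<bar>a i - real_of_int (R a i) / q\<bar>" "1/q" 2] by simp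
    qed
    also have "\<dots> = (1/4)\<^sup>2" using m by (simp add: power2_eq_square qq)
    finally have "sqrt (\<Sum>i\<in>J. (a i - real_of_int (R a i) / q)\<^sup>2) \<le> sqrt ((1/4)\<^sup>2)"
      by (rule real_sqrt_le_mono)
    then show "L2_set (\<lambda>i. a i - real_of_int (R a i) / q) J \<le> 1/4"
      unfolding L2_set_def by simp
  qed
  have Snn: "S \<ge> 0" using le_S[of "\<lambda>_. 0" "\<lambda>_. 0"] by (simp add: L2_set_def)
  \<comment> \<open>The form at \<open>(a, b)\<close> is its value at the grid pair
    \<open>(a', b')\<close> plus its values at \<open>(a - a', b)\<close> and
    \<open>(a', b - b')\<close>. By homogeneity each of the latter two is at most
    \<open>S / 4\<close>.\<close>
  have "S \<le> t + S / 2"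
    unfolding S_def
  proof (rule cSup_least[OF Vne], fold S_def)
    fix x assume "x \<in> V"
    then obtain a b where x: "x = \<bar>bilin J W a b\<bar>" and a: "L2_set a J \<le> 1" and b: "L2_set b J \<le> 1"
      unfolding V_def by blast
    define a' b' where "a' = (\<lambda>i. real_of_int (R a i) / q)" and "b' = (\<lambda>i. real_of_int (R b i) / q)"
    have 1: "\<bar>bilin J W a' b'\<bar> \<le> t"
      unfolding a'_def b'_def q_def using R(1)[OF a] R(1)[OF b] grid by simp
    have "\<bar>bilin J W (\<lambda>i. a i - a' i) b\<bar> \<le> S * L2_set (\<lambda>i. a i - a' i) J * L2_set b J" by (rule hom)
    also have "\<dots> \<le> S * (1/4) * 1"
      using Snn R(3)[OF a] b unfolding a'_def by (intro mult_mono) auto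
    finally have 2: "\<bar>bilin J W a b - bilin J W a' b\<bar> \<le> S / 4" by (simp add: bilin_diff_left)
    have "\<bar>bilin J W a' (\<lambda>i. b i - b' i)\<bar> \<le> S * L2_set a' J * L2_set (\<lambda>i. b i - b' i) J" by (rule hom)
    also have "\<dots> \<le> S * 1 * (1/4)"
      using Snn R(2)[OF a] R(3)[OF b] unfolding a'_def b'_def by (intro mult_mono) auto
    finally have "\<bar>bilin J W a' b - bilin J W a' b'\<bar> \<le> S / 4" by (simp add: bilin_diff_right)
    with 1 2 show "x \<le> t + S / 2" unfolding x by linarith
  qed
  then have S: "S \<le> 2 * t" by simp
  have "\<bar>bilin J W a b\<bar> \<le> S * (L2_set a J * L2_set b J)" using hom by (simp add: mult.assoc)
  also have "\<dots> \<le> 2 * t * (L2_set a J * L2_set b J)" using S by (intro mult_right_mono) auto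
  finally show ?thesis by (simp add: mult.assoc)
qed

section \<open>Compressions of a random sign matrix to orthonormal families\<close>

text \<open>Pythagoras: after expanding the square only the diagonal Gram entries survive. This
  keeps the Hoeffding variance at most 1 whatever orthonormal families are used.\<close>

lemma sum_square_orthonormal_comb:
  fixes p :: "'i \<Rightarrow> nat \<Rightarrow> real"
  assumes J: "finite J"
    and orth: "\<And>i j. i \<in> J \<Longrightarrow> j \<in> J \<Longrightarrow> (\<Sum>k<n. p i k * p j k) = (if i = j then 1 else 0)"
  shows "(\<Sum>k<n. (\<Sum>i\<in>J. a i * p i k)\<^sup>2) = (\<Sum>i\<in>J. (a i)\<^sup>2)"
proof -
  have "(\<Sum>k<n. (\<Sum>i\<in>J. a i * p i k)\<^sup>2) = (\<Sum>k<n. \<Sum>i\<in>J. \<Sum>j\<in>J. a i * a j * (p i k * p j k))"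
    by (simp add: power2_eq_square sum_product algebra_simps)
  also have "\<dots> = (\<Sum>i\<in>J. \<Sum>k<n. \<Sum>j\<in>J. a i * a j * (p i k * p j k))"
    by (rule sum.swap)
  also have "\<dots> = (\<Sum>i\<in>J. \<Sum>j\<in>J. \<Sum>k<n. a i * a j * (p i k * p j k))"
    by (intro sum.cong refl) (rule sum.swap)
  also have "\<dots> = (\<Sum>i\<in>J. \<Sum>j\<in>J. a i * a j * (if i = j then 1 else 0))"
    using orth by (simp flip: sum_distrib_left)
  also have "\<dots> = (\<Sum>i\<in>J. (a i)\<^sup>2)"
    using J by (simp add: power2_eq_square if_distrib[of "\<lambda>x. _ * x"] cong: if_cong)
  finally show ?thesis .
qed

text \<open>For a fixed grid pair the form is linear in the random signs, and its coefficient array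
  is the outer product of two vectors of norm at most 1. Hoeffding's inequality therefore applies
  with total variance at most 1, and the union bound runs over at most
  \<open>2 ^ (18 * card J)\<close> squared pairs.\<close>

lemma prob_compression_norm:
  fixes p q :: "'i \<Rightarrow> nat \<Rightarrow> real"
  assumes J: "finite J" and t: "t > 0"
    and p: "\<And>i j. i \<in> J \<Longrightarrow> j \<in> J \<Longrightarrow> (\<Sum>k<n. p i k * p j k) = (if i = j then 1 else 0)"
    and q: "\<And>i j. i \<in> J \<Longrightarrow> j \<in> J \<Longrightarrow> (\<Sum>k<n. q i k * q j k) = (if i = j then 1 else 0)"
  shows "measure_pmf.prob (Pi_pmf ({0..<n} \<times> {0..<n}) 0 (\<lambda>_. pmf_of_set {-1, 1 :: real}))
      {f. \<exists>a b. \<bar>bilin J (\<lambda>i j. \<Sum>k<n. \<Sum>l<n. p i k * f (k, l) * q j l) a b\<bar> > 2 * t * L2_set a J * L2_set b J}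
    \<le> 2 ^ (36 * card J) * (2 * exp (- t\<^sup>2 / 2))"
proof -
  define P where "P = Pi_pmf ({0..<n} \<times> {0..<n}) 0 (\<lambda>_. pmf_of_set {-1, 1 :: real})"
  define W where "W f i j = (\<Sum>k<n. \<Sum>l<n. p i k * f (k, l) * q j l)" for f :: "nat \<times> nat \<Rightarrow> real" and i j
  define s where "s = 4 * sqrt (real (card J))"
  define G where "G = int_grid J \<times> int_grid J"
  define X where "X zw = {f. t \<le> \<bar>bilin J (W f) (\<lambda>i. real_of_int (fst zw i) / s) (\<lambda>i. real_of_int (snd zw i) / s)\<bar>}"
    for zw :: "('i \<Rightarrow> int) \<times> ('i \<Rightarrow> int)"
  have fin: "finite G" unfolding G_def using int_grid_count[OF J] by simp
  have cardG: "real (card G) \<le> 2 ^ (36 * card J)"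
  proof -
    have "real (card G) = real (card (int_grid J)) * real (card (int_grid J))"
      by (simp add: G_def card_cartesian_product)
    also have "\<dots> \<le> 2 ^ (18 * card J) * 2 ^ (18 * card J)"
      using int_grid_count[OF J] by (intro mult_mono) auto
    finally show ?thesis by (simp flip: power_add)
  qed
  have cell: "measure_pmf.prob P (X zw) \<le> 2 * exp (- t\<^sup>2 / 2)" if "zw \<in> G" for zw
  proof -
    define a b where "a = (\<lambda>i. real_of_int (fst zw i) / s)" and "b = (\<lambda>i. real_of_int (snd zw i) / s)"
    define c where "c = (\<lambda>(k, l). (\<Sum>i\<in>J. a i * p i k) * (\<Sum>j\<in>J. b j * q j l))"
    have grid_norm: "(\<Sum>i\<in>J. (real_of_int (z i) / s)\<^sup>2) \<le> 1" if "z \<in> int_grid J" for z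
    proof (cases "J = {}")
      case False
      have "(\<Sum>i\<in>J. (real_of_int (z i) / s)\<^sup>2) = real_of_int (\<Sum>i\<in>J. (z i)\<^sup>2) / (16 * real (card J))"
        by (simp add: power_divide s_def power_mult_distrib flip: sum_divide_distrib)
      also have "\<dots> \<le> real_of_int (16 * int (card J)) / (16 * real (card J))"
      proof (rule divide_right_mono)
        have "(\<Sum>i\<in>J. (z i)\<^sup>2) \<le> 16 * int (card J)" using that by (simp add: int_grid_def)
        then show "real_of_int (\<Sum>i\<in>J. (z i)\<^sup>2) \<le> real_of_int (16 * int (card J))"
          by (simp only: of_int_le_iff)
      qed simp
      also have "\<dots> \<le> 1" by simp
      finally show ?thesis .
    qed simp
    have bil: "bilin J (W f) a b = (\<Sum>x\<in>{0..<n} \<times> {0..<n}. c x * f x)" for f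
    proof -
      have "bilin J (W f) a b = (\<Sum>i\<in>J. \<Sum>j\<in>J. \<Sum>k<n. \<Sum>l<n. (a i * p i k) * (b j * q j l) * f (k, l))"
        unfolding bilin_def W_def by (simp add: sum_distrib_left algebra_simps)
      also have "\<dots> = (\<Sum>i\<in>J. \<Sum>k<n. \<Sum>j\<in>J. \<Sum>l<n. (a i * p i k) * (b j * q j l) * f (k, l))"
        by (intro sum.cong refl) (rule sum.swap)
      also have "\<dots> = (\<Sum>k<n. \<Sum>i\<in>J. \<Sum>j\<in>J. \<Sum>l<n. (a i * p i k) * (b j * q j l) * f (k, l))"
        by (rule sum.swap)
      also have "\<dots> = (\<Sum>k<n. \<Sum>i\<in>J. \<Sum>l<n. \<Sum>j\<in>J. (a i * p i k) * (b j * q j l) * f (k, l))"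
        by (intro sum.cong refl) (rule sum.swap)
      also have "\<dots> = (\<Sum>k<n. \<Sum>l<n. \<Sum>i\<in>J. \<Sum>j\<in>J. (a i * p i k) * (b j * q j l) * f (k, l))"
        by (intro sum.cong refl) (rule sum.swap)
      also have "\<dots> = (\<Sum>k<n. \<Sum>l<n. c (k, l) * f (k, l))"
        unfolding c_def prod.case sum_product by (simp only: sum_distrib_right)
      finally show ?thesis by (simp add: sum.cartesian_product lessThan_atLeast0)
    qed
    have "(\<Sum>x\<in>{0..<n} \<times> {0..<n}. (c x)\<^sup>2)
        = (\<Sum>k<n. \<Sum>l<n. (\<Sum>i\<in>J. a i * p i k)\<^sup>2 * (\<Sum>j\<in>J. b j * q j l)\<^sup>2)"
      by (simp add: c_def lessThan_atLeast0 power_mult_distrib case_prod_unfold sum.cartesian_product)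
    also have "\<dots> = (\<Sum>k<n. (\<Sum>i\<in>J. a i * p i k)\<^sup>2) * (\<Sum>l<n. (\<Sum>j\<in>J. b j * q j l)\<^sup>2)"
      by (simp add: sum_product)
    also have "\<dots> = (\<Sum>i\<in>J. (a i)\<^sup>2) * (\<Sum>i\<in>J. (b i)\<^sup>2)"
      by (simp add: sum_square_orthonormal_comb[OF J p] sum_square_orthonormal_comb[OF J q])
    also have "\<dots> \<le> 1"
      using that grid_norm unfolding a_def b_def G_def
      by (intro mult_le_one) (auto intro: sum_nonneg)
    finally have "(\<Sum>x\<in>{0..<n} \<times> {0..<n}. (c x)\<^sup>2) \<le> 1" .
    from rademacher_sum_tail[OF _ this t] show ?thesis
      unfolding X_def P_def by (simp add: bil[unfolded a_def b_def])
  qed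
  \<comment> \<open>The event ranges over uncountably many \<open>a\<close> and \<open>b\<close>;
    the net argument in contrapositive form places it inside finitely many cells.\<close>
  have "{f. \<exists>a b. \<bar>bilin J (W f) a b\<bar> > 2 * t * L2_set a J * L2_set b J} \<subseteq> (\<Union>zw\<in>G. X zw)"
  proof
    fix f assume "f \<in> {f. \<exists>a b. \<bar>bilin J (W f) a b\<bar> > 2 * t * L2_set a J * L2_set b J}"
    then obtain a b where ab: "\<not> \<bar>bilin J (W f) a b\<bar> \<le> 2 * t * L2_set a J * L2_set b J"
      by (auto simp: not_le)
    have "\<exists>z\<in>int_grid J. \<exists>w\<in>int_grid J.
      \<not> \<bar>bilin J (W f) (\<lambda>i. real_of_int (z i) / s) (\<lambda>i. real_of_int (w i) / s)\<bar> \<le> t"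
      using ab bilin_le_grid[OF J, of "W f" t a b] unfolding s_def by blast
    then obtain z w where "z \<in> int_grid J" "w \<in> int_grid J"
      "t \<le> \<bar>bilin J (W f) (\<lambda>i. real_of_int (z i) / s) (\<lambda>i. real_of_int (w i) / s)\<bar>"
      by (auto simp: not_le)
    then have "(z, w) \<in> G" "f \<in> X (z, w)" by (auto simp: G_def X_def)
    then show "f \<in> (\<Union>zw\<in>G. X zw)" by blast
  qed
  then have "measure_pmf.prob P {f. \<exists>a b. \<bar>bilin J (W f) a b\<bar> > 2 * t * L2_set a J * L2_set b J}
      \<le> measure_pmf.prob P (\<Union>zw\<in>G. X zw)"
    by (intro measure_pmf.finite_measure_mono) auto
  also have "\<dots> \<le> (\<Sum>zw\<in>G. measure_pmf.prob P (X zw))"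
    using fin by (intro measure_pmf.finite_measure_subadditive_finite) auto
  also have "\<dots> \<le> (\<Sum>zw\<in>G. 2 * exp (- t\<^sup>2 / 2))" by (intro sum_mono cell)
  also have "\<dots> \<le> 2 ^ (36 * card J) * (2 * exp (- t\<^sup>2 / 2))"
    using cardG by (simp add: mult_right_mono)
  finally show ?thesis unfolding P_def W_def .
qed

subsection \<open>Orthonormal families and singular systems\<close>

text \<open>A linear combination given by coordinates, so that its dimension is \<open>n\<close>
  unconditionally and exchanging sums is enough for all its algebra.\<close>

definition comb :: "nat \<Rightarrow> ('i \<Rightarrow> real vec) \<Rightarrow> 'i set \<Rightarrow> ('i \<Rightarrow> real) \<Rightarrow> real vec" where
  "comb n v J c = Matrix.vec n (\<lambda>l. \<Sum>j\<in>J. c j * v j $ l)"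

lemma comb_carrier [simp]: "comb n v J c \<in> carrier_vec n"
  by (simp add: comb_def)

lemma scalar_prod_comb_left:
  assumes "\<And>j. j \<in> J \<Longrightarrow> v j \<in> carrier_vec n" "x \<in> carrier_vec n"
  shows "comb n v J c \<bullet> x = (\<Sum>j\<in>J. c j * (v j \<bullet> x))"
proof -
  have "comb n v J c \<bullet> x = (\<Sum>l\<in>{0..<n}. \<Sum>j\<in>J. c j * v j $ l * x $ l)"
    using assms by (simp add: comb_def scalar_prod_def sum_distrib_right)
  also have "\<dots> = (\<Sum>j\<in>J. \<Sum>l\<in>{0..<n}. c j * v j $ l * x $ l)" by (rule sum.swap)
  also have "\<dots> = (\<Sum>j\<in>J. c j * (v j \<bullet> x))"
    using assms by (simp add: scalar_prod_def sum_distrib_left mult.assoc)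
  finally show ?thesis .
qed

lemma scalar_prod_comb_right:
  assumes "\<And>j. j \<in> J \<Longrightarrow> v j \<in> carrier_vec n" "x \<in> carrier_vec n"
  shows "x \<bullet> comb n v J c = (\<Sum>j\<in>J. c j * (x \<bullet> v j))"
proof -
  have "x \<bullet> comb n v J c = comb n v J c \<bullet> x" using assms by (intro comm_scalar_prod) auto
  also have "\<dots> = (\<Sum>j\<in>J. c j * (v j \<bullet> x))" using assms by (rule scalar_prod_comb_left)
  also have "\<dots> = (\<Sum>j\<in>J. c j * (x \<bullet> v j))"
    using assms by (intro sum.cong refl) (metis comm_scalar_prod)
  finally show ?thesis .
qed

lemma mult_mat_vec_comb:
  assumes "\<And>j. j \<in> J \<Longrightarrow> v j \<in> carrier_vec n" "A \<in> carrier_mat m n"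
  shows "A *\<^sub>v comb n v J c = comb m (\<lambda>j. A *\<^sub>v v j) J c"
proof (rule eq_vecI)
  fix l assume "l < dim_vec (comb m (\<lambda>j. A *\<^sub>v v j) J c)"
  then have l: "l < m" by (simp add: comb_def)
  have "(A *\<^sub>v comb n v J c) $ l = row A l \<bullet> comb n v J c" using assms l by simp
  also have "\<dots> = (\<Sum>j\<in>J. c j * (row A l \<bullet> v j))"
    using assms l by (intro scalar_prod_comb_right) auto
  finally show "(A *\<^sub>v comb n v J c) $ l = comb m (\<lambda>j. A *\<^sub>v v j) J c $ l"
    using assms l by (simp add: comb_def)
qed (use assms in \<open>simp add: comb_def\<close>)

lemma comb_cong:
  assumes "\<And>j. j \<in> J \<Longrightarrow> c j = d j" "\<And>j. j \<in> J \<Longrightarrow> v j = w j"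
  shows "comb n v J c = comb n w J d"
  using assms by (simp add: comb_def cong: sum.cong)

lemma comb_add: "comb n v J c + comb n v J d = comb n v J (\<lambda>i. c i + d i)"
  by (rule eq_vecI) (simp_all add: comb_def distrib_right sum.distrib)

lemma comb_union:
  "finite J \<Longrightarrow> finite K \<Longrightarrow> J \<inter> K = {} \<Longrightarrow> comb n v (J \<union> K) c = comb n v J c + comb n v K c"
  by (rule eq_vecI) (simp_all add: comb_def sum.union_disjoint)

lemma scalar_prod_self_nonneg: "0 \<le> x \<bullet> (x :: real vec)"
  by (simp add: scalar_prod_def sum_nonneg)

lemma scalar_prod_self_zero:
  fixes x :: "real vec"
  assumes "x \<in> carrier_vec n" "x \<bullet> x = 0"
  shows "x = 0\<^sub>v n"
  using assms by (intro eq_vecI) (auto simp: scalar_prod_def sum_nonneg_eq_0_iff)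

lemma scalar_prod_le_norms:
  fixes x y :: "real vec"
  assumes "x \<in> carrier_vec n" "y \<in> carrier_vec n"
  shows "\<bar>x \<bullet> y\<bar> \<le> sqrt (x \<bullet> x) * sqrt (y \<bullet> y)"
proof -
  have "\<bar>x \<bullet> y\<bar> \<le> (\<Sum>i\<in>{0..<n}. \<bar>x $ i\<bar> * \<bar>y $ i\<bar>)"
    using assms unfolding scalar_prod_def by (auto intro: order.trans[OF sum_abs] simp: abs_mult)
  also have "\<dots> \<le> L2_set (($) x) {0..<n} * L2_set (($) y) {0..<n}" by (rule L2_set_mult_ineq)
  also have "\<dots> = sqrt (x \<bullet> x) * sqrt (y \<bullet> y)"
    using assms by (simp add: L2_set_def scalar_prod_def power2_eq_square)
  finally show ?thesis .
qed

text \<open>A square matrix with orthonormal rows has a two-sided inverse in its transpose, so it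
  preserves scalar products. Its rows are numbered from 0, hence the shift by
  \<open>Suc\<close>.\<close>

lemma orthonormal_parseval:
  fixes v :: "nat \<Rightarrow> real vec"
  assumes v: "\<And>i. i \<in> {1..n} \<Longrightarrow> v i \<in> carrier_vec n"
    and orth: "\<And>i j. i \<in> {1..n} \<Longrightarrow> j \<in> {1..n} \<Longrightarrow> v i \<bullet> v j = (if i = j then 1 else 0)"
    and x: "x \<in> carrier_vec n" and y: "y \<in> carrier_vec n"
  shows "x \<bullet> y = (\<Sum>i\<in>{1..n}. (v i \<bullet> x) * (v i \<bullet> y))"
proof -
  define Q where "Q = Matrix.mat n n (\<lambda>(i, l). v (Suc i) $ l)"
  have Q: "Q \<in> carrier_mat n n" "Q\<^sup>T \<in> carrier_mat n n" by (auto simp: Q_def)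
  have row: "row Q i = v (Suc i)" if "i < n" for i
    using that v[of "Suc i"] by (intro eq_vecI) (auto simp: Q_def)
  have "Q * Q\<^sup>T = 1\<^sub>m n"
    by (rule eq_matI) (use Q orth row in auto)
  then have QQ: "Q\<^sup>T * Q = 1\<^sub>m n" using mat_mult_left_right_inverse Q by blast
  have "x \<bullet> y = x \<bullet> ((Q\<^sup>T * Q) *\<^sub>v y)" using y by (simp add: QQ)
  also have "\<dots> = x \<bullet> (Q\<^sup>T *\<^sub>v (Q *\<^sub>v y))" using Q y by (simp add: assoc_mult_mat_vec)
  also have "\<dots> = (Q *\<^sub>v x) \<bullet> (Q *\<^sub>v y)"
    using Q x y by (metis assoc_scalar_prod mult_mat_vec_carrier transpose_vec_mult_scalar
        transpose_transpose comm_scalar_prod)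
  also have "\<dots> = (\<Sum>i\<in>{0..<n}. (v (Suc i) \<bullet> x) * (v (Suc i) \<bullet> y))"
    using Q row by (simp add: scalar_prod_def[of "Q *\<^sub>v x"])
  also have "\<dots> = (\<Sum>i\<in>{1..n}. (v i \<bullet> x) * (v i \<bullet> y))"
    by (rule sum.reindex_bij_witness[of _ "\<lambda>i. i - 1" Suc]) auto
  finally show ?thesis .
qed

lemma orthonormal_expansion:
  fixes v :: "nat \<Rightarrow> real vec"
  assumes v: "\<And>i. i \<in> {1..n} \<Longrightarrow> v i \<in> carrier_vec n"
    and orth: "\<And>i j. i \<in> {1..n} \<Longrightarrow> j \<in> {1..n} \<Longrightarrow> v i \<bullet> v j = (if i = j then 1 else 0)"
    and x: "x \<in> carrier_vec n"
  shows "x = comb n v {1..n} (\<lambda>i. v i \<bullet> x)"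
proof (rule eq_vecI)
  fix l assume "l < dim_vec (comb n v {1..n} (\<lambda>i. v i \<bullet> x))"
  then have l: "l < n" by (simp add: comb_def)
  have "x $ l = x \<bullet> unit_vec n l" using x l by simp
  also have "\<dots> = (\<Sum>i\<in>{1..n}. (v i \<bullet> x) * (v i \<bullet> unit_vec n l))"
    by (rule orthonormal_parseval[OF v orth x]) auto
  also have "\<dots> = (\<Sum>i\<in>{1..n}. (v i \<bullet> x) * v i $ l)" using v l by simp
  finally show "x $ l = comb n v {1..n} (\<lambda>i. v i \<bullet> x) $ l" using l by (simp add: comb_def)
qed (use x in \<open>simp add: comb_def\<close>)

text \<open>The weights \<open>s\<close> allow families that are orthogonal but not normalised:
  weight 1 fits the \<open>v i\<close>, and weight \<open>(\<sigma> i)\<^sup>2\<close> fits their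
  images under \<open>A\<close>.\<close>

lemma scalar_prod_comb_comb:
  fixes v :: "'i \<Rightarrow> real vec"
  assumes J: "finite J" and v: "\<And>i. i \<in> J \<Longrightarrow> v i \<in> carrier_vec n"
    and orth: "\<And>i j. i \<in> J \<Longrightarrow> j \<in> J \<Longrightarrow> v i \<bullet> v j = (if i = j then s i else 0)"
  shows "comb n v J a \<bullet> comb n v J b = (\<Sum>i\<in>J. s i * a i * b i)"
proof -
  have "comb n v J a \<bullet> comb n v J b = (\<Sum>i\<in>J. a i * (\<Sum>j\<in>J. b j * (if i = j then s i else 0)))"
    by (subst scalar_prod_comb_left, use v in \<open>simp_all add: scalar_prod_comb_right orth cong: sum.cong\<close>)
  also have "\<dots> = (\<Sum>i\<in>J. s i * a i * b i)"
    using J by (simp add: if_distrib[of "\<lambda>x. _ * x"] algebra_simps cong: if_cong)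
  finally show ?thesis .
qed

text \<open>More unknowns than equations: the Gram matrix padded with a zero row is singular.\<close>

lemma exists_unit_comb_orthogonal:
  fixes v w :: "nat \<Rightarrow> real vec"
  assumes k: "k \<ge> 1" and v: "\<And>i. i \<in> {1..k} \<Longrightarrow> v i \<in> carrier_vec n"
    and w: "\<And>i. i \<in> {1..<k} \<Longrightarrow> w i \<in> carrier_vec n"
  shows "\<exists>b. (\<Sum>i\<in>{1..k}. (b i)\<^sup>2) = 1 \<and> (\<forall>j\<in>{1..<k}. w j \<bullet> comb n v {1..k} b = 0)"
proof -
  define g where "g r = Matrix.vec k (\<lambda>c. w (Suc r) \<bullet> v (Suc c))" for r
  \<comment> \<open>Rows \<open>0\<close> to \<open>k - 2\<close> encode the \<open>k - 1\<close>
    orthogonality conditions; row \<open>k - 1\<close> is the padding that makes the matrix square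
    and forces its determinant to vanish.\<close>
  define G where "G = mat\<^sub>r k k (\<lambda>r. if r = k - 1 then 0\<^sub>v k else g r)"
  have G: "G \<in> carrier_mat k k" by (simp add: G_def)
  have "det G = 0" unfolding G_def by (rule det_row_0) (use k in \<open>auto simp: g_def\<close>)
  then obtain y where y: "y \<in> carrier_vec k" "y \<noteq> 0\<^sub>v k" "G *\<^sub>v y = 0\<^sub>v k"
    using det_0_iff_vec_prod_zero_field[OF G] by blast
  define S where "S = (\<Sum>i\<in>{1..k}. (y $ (i - 1))\<^sup>2)"
  obtain i where i: "i < k" "y $ i \<noteq> 0" using y by (metis carrier_vecD eq_vecI index_zero_vec)
  have "S > 0" unfolding S_def
    by (rule sum_pos2[of _ "Suc i"]) (use i in auto)
  define b where "b i = y $ (i - 1) / sqrt S" for i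
  have "(\<Sum>i\<in>{1..k}. (b i)\<^sup>2) = 1"
    using \<open>S > 0\<close> unfolding b_def power_divide sum_divide_distrib[symmetric] S_def[symmetric] by simp
  moreover have "w j \<bullet> comb n v {1..k} b = 0" if j: "j \<in> {1..<k}" for j
  proof -
    have "w j \<bullet> comb n v {1..k} b = (\<Sum>i\<in>{1..k}. b i * (w j \<bullet> v i))"
      by (rule scalar_prod_comb_right) (use v w j in auto)
    also have "\<dots> = (\<Sum>i\<in>{1..k}. y $ (i - 1) * (w j \<bullet> v i)) / sqrt S"
      by (simp add: b_def sum_divide_distrib)
    also have "(\<Sum>i\<in>{1..k}. y $ (i - 1) * (w j \<bullet> v i)) = (\<Sum>i\<in>{0..<k}. (w j \<bullet> v (Suc i)) * y $ i)"
      by (rule sum.reindex_bij_witness[of _ Suc "\<lambda>i. i - 1"]) auto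
    also have "\<dots> = g (j - 1) \<bullet> y"
      using j y(1) by (simp add: g_def scalar_prod_def[of _ y])
    also have "\<dots> = (G *\<^sub>v y) $ (j - 1)"
    proof -
      have "row G (j - 1) = g (j - 1)" using j by (intro eq_vecI) (auto simp: G_def g_def)
      moreover have "j - 1 < dim_row G" using j G by auto
      ultimately show ?thesis by (simp only: index_mult_mat_vec)
    qed
    also have "\<dots> = 0"
      unfolding y(3) by (rule index_zero_vec) (use j in auto)
    finally show ?thesis by simp
  qed
  ultimately show ?thesis by blast
qed

section \<open>Spectral facts for a single singular system\<close>

context
  fixes n :: nat and M :: "real mat" and \<sigma> :: "nat \<Rightarrow> real" and v :: "nat \<Rightarrow> real vec"
  assumes M: "M \<in> carrier_mat n n" and sys: "right_singular_system M \<sigma> v"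
begin

lemma singular_vector_carrier: "i \<in> {1..n} \<Longrightarrow> v i \<in> carrier_vec n"
  using sys M unfolding right_singular_system_def eigenvector_def by auto

lemma singular_vector_orthonormal:
  "i \<in> {1..n} \<Longrightarrow> j \<in> {1..n} \<Longrightarrow> v i \<bullet> v j = (if i = j then 1 else 0)"
  using sys M unfolding right_singular_system_def by auto

lemma singular_value_nonneg: "i \<in> {1..n} \<Longrightarrow> 0 \<le> \<sigma> i"
  and singular_value_antimono: "i \<in> {1..n} \<Longrightarrow> j \<in> {1..n} \<Longrightarrow> i \<le> j \<Longrightarrow> \<sigma> j \<le> \<sigma> i"
  using sys M unfolding right_singular_system_def by auto

lemma singular_parseval:
  assumes "x \<in> carrier_vec n" "y \<in> carrier_vec n"
  shows "x \<bullet> y = (\<Sum>i\<in>{1..n}. (v i \<bullet> x) * (v i \<bullet> y))"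
  using singular_vector_carrier singular_vector_orthonormal assms by (rule orthonormal_parseval)

lemma singular_expansion:
  assumes "x \<in> carrier_vec n"
  shows "x = comb n v {1..n} (\<lambda>i. v i \<bullet> x)"
  using singular_vector_carrier singular_vector_orthonormal assms by (rule orthonormal_expansion)

text \<open>The eigenvalue equation in weak form, moved through the transpose. Taking
  \<open>x\<close> to be a singular vector shows that the images of the \<open>v i\<close> are
  orthogonal with norms \<open>\<sigma> i\<close>; a general \<open>x\<close> is needed to test
  against the kernel component.\<close>

lemma singular_vector_gram:
  assumes i: "i \<in> {1..n}" and x: "x \<in> carrier_vec n"
  shows "(M *\<^sub>v v i) \<bullet> (M *\<^sub>v x) = (\<sigma> i)\<^sup>2 * (v i \<bullet> x)"
proof -
  have "eigenvector (M\<^sup>T * M) (v i) ((\<sigma> i)\<^sup>2)"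
    using sys M i unfolding right_singular_system_def by auto
  then have eig: "(M\<^sup>T * M) *\<^sub>v v i = (\<sigma> i)\<^sup>2 \<cdot>\<^sub>v v i"
    unfolding eigenvector_def by blast
  have MT: "M\<^sup>T \<in> carrier_mat n n" using M by simp
  have vi: "v i \<in> carrier_vec n" using i by (rule singular_vector_carrier)
  have "(M *\<^sub>v v i) \<bullet> (M *\<^sub>v x) = (M\<^sup>T *\<^sub>v (M *\<^sub>v v i)) \<bullet> x"
    using transpose_vec_mult_scalar[OF M x, of "M *\<^sub>v v i"] M vi by simp
  also have "M\<^sup>T *\<^sub>v (M *\<^sub>v v i) = (\<sigma> i)\<^sup>2 \<cdot>\<^sub>v v i"
    using eig assoc_mult_mat_vec[OF MT M vi] by simp
  finally show ?thesis using vi x by simp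
qed

lemma singular_energy:
  assumes x: "x \<in> carrier_vec n"
  shows "(M *\<^sub>v x) \<bullet> (M *\<^sub>v x) = (\<Sum>i\<in>{1..n}. (\<sigma> i)\<^sup>2 * (v i \<bullet> x)\<^sup>2)"
proof -
  have "M *\<^sub>v x = M *\<^sub>v comb n v {1..n} (\<lambda>i. v i \<bullet> x)"
    using singular_expansion[OF x] by simp
  also have "\<dots> = comb n (\<lambda>i. M *\<^sub>v v i) {1..n} (\<lambda>i. v i \<bullet> x)"
    by (rule mult_mat_vec_comb) (use M singular_vector_carrier in auto)
  finally have "(M *\<^sub>v x) \<bullet> (M *\<^sub>v x)
      = comb n (\<lambda>i. M *\<^sub>v v i) {1..n} (\<lambda>i. v i \<bullet> x) \<bullet> (M *\<^sub>v x)" by simp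
  also have "\<dots> = (\<Sum>i\<in>{1..n}. (v i \<bullet> x) * ((M *\<^sub>v v i) \<bullet> (M *\<^sub>v x)))"
    by (rule scalar_prod_comb_left) (use M singular_vector_carrier x in auto)
  also have "\<dots> = (\<Sum>i\<in>{1..n}. (\<sigma> i)\<^sup>2 * (v i \<bullet> x)\<^sup>2)"
    using x by (intro sum.cong refl) (simp add: singular_vector_gram power2_eq_square)
  finally show ?thesis .
qed

lemma singular_kernel:
  assumes i: "i \<in> {1..n}" and "\<sigma> i = 0"
  shows "M *\<^sub>v v i = 0\<^sub>v n"
proof -
  have "(M *\<^sub>v v i) \<bullet> (M *\<^sub>v v i) = 0"
    using singular_vector_gram[OF i singular_vector_carrier[OF i]] assms by simp
  moreover have "M *\<^sub>v v i \<in> carrier_vec n" using M singular_vector_carrier[OF i] by simp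
  ultimately show ?thesis by (rule scalar_prod_self_zero[rotated])
qed

end

subsection \<open>The deterministic perturbation bound\<close>

text \<open>Purely deterministic: \<open>B\<close> bounds the operator norm of \<open>E\<close>, and
  \<open>T\<close> bounds its form between the left singular vectors \<open>u i\<close> and the
  right ones \<open>v j\<close> with positive singular value. The assumption
  \<open>2 * T \<le> \<sigma> k\<close> keeps the perturbed singular value above
  \<open>\<sigma> k / 2\<close>. The factor in front of the squared sine is the one by which the
  terms of the final maximum are divided.\<close>

lemma singular_vector_perturbation:
  fixes A E :: "real mat" and n k :: nat and \<sigma> \<sigma>' :: "nat \<Rightarrow> real" and v v' :: "nat \<Rightarrow> real vec"
  defines "I \<equiv> {i. 1 \<le> i \<and> i \<le> n \<and> 0 < \<sigma> i}"
    and "u \<equiv> \<lambda>i. (1 / \<sigma> i) \<cdot>\<^sub>v (A *\<^sub>v v i)"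
    and "s \<equiv> sqrt (\<Sum>i\<in>{1..<k}. 1 - (v i \<bullet> v' i)\<^sup>2)"
  assumes A: "A \<in> carrier_mat n n" and E: "E \<in> carrier_mat n n"
    and k: "1 \<le> k" "k < n"
    and sysA: "right_singular_system A \<sigma> v"
    and sysM: "right_singular_system (A + E) \<sigma>' v'"
    and gap: "\<sigma> (k + 1) < \<sigma> k"
    and B: "\<And>x y. x \<in> carrier_vec n \<Longrightarrow> y \<in> carrier_vec n \<Longrightarrow>
      \<bar>x \<bullet> (E *\<^sub>v y)\<bar> \<le> B * sqrt (x \<bullet> x) * sqrt (y \<bullet> y)"
    and T: "\<And>a b. \<bar>bilin I (\<lambda>i j. u i \<bullet> (E *\<^sub>v v j)) a b\<bar> \<le> T * L2_set a I * L2_set b I"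
    and nonneg: "0 \<le> B" "0 \<le> T" and small: "2 * T \<le> \<sigma> k"
  shows "\<sigma> k * (\<sigma> k - \<sigma> (k + 1)) * (1 - (v k \<bullet> v' k)\<^sup>2)
    \<le> (\<sigma> 1)\<^sup>2 * s\<^sup>2 + 2 * B * \<sigma> 1 * s + 4 * T * \<sigma> k + 5 * B\<^sup>2"
proof -
  define M where "M = A + E"
  have M: "M \<in> carrier_mat n n" unfolding M_def using A E by simp
  note sysM = sysM[folded M_def]
  note vc = singular_vector_carrier[OF A sysA] and v'c = singular_vector_carrier[OF M sysM]
  note vo = singular_vector_orthonormal[OF A sysA] and v'o = singular_vector_orthonormal[OF M sysM]
  note \<sigma>nn = singular_value_nonneg[OF A sysA] and \<sigma>'nn = singular_value_nonneg[OF M sysM]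
  note \<sigma>mono = singular_value_antimono[OF A sysA] and \<sigma>'mono = singular_value_antimono[OF M sysM]
  have I: "I \<subseteq> {1..n}" "finite I" unfolding I_def by (auto intro: finite_subset[of _ "{1..n}"])
  have \<sigma>k: "0 < \<sigma> k" using gap \<sigma>nn[of "k + 1"] k by simp
  have kI: "{1..k} \<subseteq> I"
    using \<sigma>k \<sigma>mono[of _ k] k unfolding I_def by (force intro: less_le_trans)
  have vcI: "v i \<in> carrier_vec n" if "i \<in> I" for i using that I vc by blast
  have voI: "v i \<bullet> v j = (if i = j then 1 else 0)" if "i \<in> I" "j \<in> I" for i j
    using that I vo by blast
  have AvI: "A *\<^sub>v v i \<in> carrier_vec n" if "i \<in> I" for i using A vcI[OF that] by simp
  have gramI: "(A *\<^sub>v v i) \<bullet> (A *\<^sub>v v j) = (if i = j then (\<sigma> i)\<^sup>2 else 0)" if "i \<in> I" "j \<in> I" for i j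
    using singular_vector_gram[OF A sysA, of i "v j"] that I vcI voI by auto
  have Mx: "M *\<^sub>v x = A *\<^sub>v x + E *\<^sub>v x" if "x \<in> carrier_vec n" for x
    unfolding M_def using A E that by (rule add_mult_distrib_mat_vec)
  have Ac: "A *\<^sub>v x \<in> carrier_vec n" and Ec: "E *\<^sub>v x \<in> carrier_vec n" and Mc: "M *\<^sub>v x \<in> carrier_vec n"
    if "x \<in> carrier_vec n" for x
    using A E M that by auto
  have Acomb: "A *\<^sub>v comb n v I a = comb n (\<lambda>i. A *\<^sub>v v i) I a" for a
    using vcI A by (rule mult_mat_vec_comb)
  have dot_comb: "comb n v I a \<bullet> comb n v I b = (\<Sum>i\<in>I. a i * b i)" for a b
    using scalar_prod_comb_comb[OF I(2) vcI voI] by simp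
  have energy_comb: "(A *\<^sub>v comb n v I a) \<bullet> (A *\<^sub>v comb n v I b) = (\<Sum>i\<in>I. (\<sigma> i)\<^sup>2 * a i * b i)" for a b
    unfolding Acomb using scalar_prod_comb_comb[OF I(2) AvI gramI] by simp
  \<comment> \<open>In the orthonormal family \<open>u\<close> the image of the combination with
    coefficients \<open>a\<close> has coordinates \<open>\<sigma> i * a i\<close>, so the norm on
    the left of the form is exactly the norm of that image.\<close>
  have cross: "\<bar>(A *\<^sub>v comb n v I a) \<bullet> (E *\<^sub>v comb n v I b)\<bar>
      \<le> T * sqrt ((A *\<^sub>v comb n v I a) \<bullet> (A *\<^sub>v comb n v I a)) * sqrt (\<Sum>i\<in>I. (b i)\<^sup>2)" for a b
  proof -
    have "(A *\<^sub>v comb n v I a) \<bullet> (E *\<^sub>v comb n v I b)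
        = comb n (\<lambda>i. A *\<^sub>v v i) I a \<bullet> comb n (\<lambda>j. E *\<^sub>v v j) I b"
      unfolding Acomb by (subst mult_mat_vec_comb[OF vcI E]) auto
    also have "\<dots> = (\<Sum>i\<in>I. a i * (\<Sum>j\<in>I. b j * ((A *\<^sub>v v i) \<bullet> (E *\<^sub>v v j))))"
      using AvI vcI E by (subst scalar_prod_comb_left)
        (auto intro!: sum.cong simp: scalar_prod_comb_right[where n = n])
    also have "\<dots> = bilin I (\<lambda>i j. u i \<bullet> (E *\<^sub>v v j)) (\<lambda>i. \<sigma> i * a i) b"
      unfolding bilin_def sum_distrib_left
    proof (intro sum.cong refl)
      fix i j assume ij: "i \<in> I" "j \<in> I"
      then have "\<sigma> i \<noteq> 0" by (simp add: I_def)
      moreover have "u i \<bullet> (E *\<^sub>v v j) = (1 / \<sigma> i) * ((A *\<^sub>v v i) \<bullet> (E *\<^sub>v v j))"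
        unfolding u_def by (rule smult_scalar_prod_distrib[OF AvI[OF ij(1)] Ec[OF vcI[OF ij(2)]]])
      ultimately show "a i * (b j * ((A *\<^sub>v v i) \<bullet> (E *\<^sub>v v j))) = \<sigma> i * a i * b j * (u i \<bullet> (E *\<^sub>v v j))"
        by simp
    qed
    finally have eq: "(A *\<^sub>v comb n v I a) \<bullet> (E *\<^sub>v comb n v I b)
      = bilin I (\<lambda>i j. u i \<bullet> (E *\<^sub>v v j)) (\<lambda>i. \<sigma> i * a i) b" .
    have "L2_set (\<lambda>i. \<sigma> i * a i) I = sqrt ((A *\<^sub>v comb n v I a) \<bullet> (A *\<^sub>v comb n v I a))"
      unfolding energy_comb L2_set_def by (simp add: power2_eq_square algebra_simps)
    then show ?thesis using T[of "\<lambda>i. \<sigma> i * a i" b] unfolding eq by (simp add: L2_set_def)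
  qed

  \<comment> \<open>Dimension count: a unit \<open>z\<close> in the span of \<open>v 1\<close> to
    \<open>v k\<close> is orthogonal to the first \<open>k - 1\<close> vectors \<open>v'\<close>, so
    \<open>M z\<close> has norm at most \<open>\<sigma>' k\<close>, while \<open>A z\<close> has
    norm \<open>\<rho> \<ge> \<sigma> k\<close>. The triangle inequality would lose
    \<open>B\<close>. Pairing \<open>M z\<close> with \<open>A z\<close> instead exposes
    \<open>E\<close> only through the compressed form, and dividing by \<open>\<rho>\<close> loses
    just \<open>T\<close>.\<close>
  have lower: "\<sigma> k - T \<le> \<sigma>' k"
  proof -
    obtain b where b: "(\<Sum>i\<in>{1..k}. (b i)\<^sup>2) = 1" "\<And>j. j \<in> {1..<k} \<Longrightarrow> v' j \<bullet> comb n v {1..k} b = 0"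
      using exists_unit_comb_orthogonal[of k v n v'] k vc v'c by auto
    \<comment> \<open>Extension by zero to \<open>I\<close>, the index set on which the bound
      \<open>T\<close> is available.\<close>
    define b' where "b' i = (if i \<in> {1..k} then b i else 0)" for i
    define z where "z = comb n v I b'"
    have zc: "z \<in> carrier_vec n" by (simp add: z_def)
    have "z = comb n v {1..k} b"
      unfolding z_def comb_def b'_def
      by (intro arg_cong[where f = "Matrix.vec n"] ext sum.mono_neutral_cong_right) (use I kI in auto)
    then have orth: "v' j \<bullet> z = 0" if "j \<in> {1..<k}" for j using b(2) that by simp
    have sumI: "(\<Sum>i\<in>I. f i * (b' i)\<^sup>2) = (\<Sum>i\<in>{1..k}. f i * (b i)\<^sup>2)" for f
      by (rule sum.mono_neutral_cong_right) (use I kI in \<open>auto simp: b'_def\<close>)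
    have zz: "z \<bullet> z = 1"
      using sumI[of "\<lambda>_. 1"] b(1) unfolding z_def dot_comb by (simp add: power2_eq_square)
    have "(M *\<^sub>v z) \<bullet> (M *\<^sub>v z) = (\<Sum>i\<in>{1..n}. (\<sigma>' i)\<^sup>2 * (v' i \<bullet> z)\<^sup>2)"
      by (rule singular_energy[OF M sysM zc])
    also have "\<dots> \<le> (\<Sum>i\<in>{1..n}. (\<sigma>' k)\<^sup>2 * (v' i \<bullet> z)\<^sup>2)"
    proof (rule sum_mono)
      fix i assume i: "i \<in> {1..n}"
      show "(\<sigma>' i)\<^sup>2 * (v' i \<bullet> z)\<^sup>2 \<le> (\<sigma>' k)\<^sup>2 * (v' i \<bullet> z)\<^sup>2"
      proof (cases "i < k")
        case True then show ?thesis using i orth by simp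
      next
        case False
        then have "(\<sigma>' i)\<^sup>2 \<le> (\<sigma>' k)\<^sup>2" using i k \<sigma>'mono[of k i] \<sigma>'nn[of i] by (intro power_mono) auto
        then show ?thesis by (rule mult_right_mono) simp
      qed
    qed
    also have "\<dots> = (\<sigma>' k)\<^sup>2"
      using singular_parseval[OF M sysM zc zc] zz by (simp add: power2_eq_square flip: sum_distrib_left)
    finally have "sqrt ((M *\<^sub>v z) \<bullet> (M *\<^sub>v z)) \<le> \<sigma>' k" using \<sigma>'nn[of k] k by (simp add: real_le_lsqrt)
    define \<rho> where "\<rho> = sqrt ((A *\<^sub>v z) \<bullet> (A *\<^sub>v z))"
    have "(\<Sum>i\<in>{1..k}. (\<sigma> k)\<^sup>2 * (b i)\<^sup>2) \<le> (\<Sum>i\<in>{1..k}. (\<sigma> i)\<^sup>2 * (b i)\<^sup>2)"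
      using \<sigma>mono[of _ k] \<sigma>k k by (intro sum_mono mult_right_mono power_mono) auto
    also have "\<dots> = (A *\<^sub>v z) \<bullet> (A *\<^sub>v z)"
      unfolding z_def energy_comb sumI[symmetric] by (simp add: power2_eq_square mult.assoc)
    finally have "(\<sigma> k)\<^sup>2 \<le> (A *\<^sub>v z) \<bullet> (A *\<^sub>v z)"
      using b(1) by (simp flip: sum_distrib_left)
    then have \<rho>: "\<sigma> k \<le> \<rho>" unfolding \<rho>_def by (rule real_le_rsqrt)
    have \<rho>2: "\<rho>\<^sup>2 = (A *\<^sub>v z) \<bullet> (A *\<^sub>v z)" unfolding \<rho>_def by (simp add: scalar_prod_self_nonneg)
    have "\<bar>(A *\<^sub>v z) \<bullet> (E *\<^sub>v z)\<bar> \<le> T * \<rho> * 1"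
      using cross[of b' b'] sumI[of "\<lambda>_. 1"] b(1) unfolding z_def[symmetric] \<rho>_def[symmetric] by simp
    moreover have "(A *\<^sub>v z) \<bullet> (M *\<^sub>v z) = \<rho>\<^sup>2 + (A *\<^sub>v z) \<bullet> (E *\<^sub>v z)"
      unfolding Mx[OF zc] \<rho>2 by (rule scalar_prod_add_distrib[OF Ac[OF zc] Ac[OF zc] Ec[OF zc]])
    moreover have "(A *\<^sub>v z) \<bullet> (M *\<^sub>v z) \<le> \<rho> * \<sigma>' k"
    proof -
      have "(A *\<^sub>v z) \<bullet> (M *\<^sub>v z) \<le> \<rho> * sqrt ((M *\<^sub>v z) \<bullet> (M *\<^sub>v z))"
        using scalar_prod_le_norms[OF Ac[OF zc] Mc[OF zc]] unfolding \<rho>_def by linarith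
      also have "\<dots> \<le> \<rho> * \<sigma>' k"
        using \<rho> \<sigma>k \<open>sqrt ((M *\<^sub>v z) \<bullet> (M *\<^sub>v z)) \<le> \<sigma>' k\<close> by (intro mult_left_mono) auto
      finally show ?thesis .
    qed
    ultimately have "\<rho> * (\<rho> - T) \<le> \<rho> * \<sigma>' k" by (simp add: power2_eq_square algebra_simps)
    then have "\<rho> - T \<le> \<sigma>' k" using \<rho> \<sigma>k by simp
    with \<rho> show ?thesis by simp
  qed
  then have \<sigma>'k: "\<sigma> k / 2 \<le> \<sigma>' k" using small by linarith

  define x where "x = v' k"
  have xc: "x \<in> carrier_vec n" unfolding x_def using k by (intro v'c) simp
  have xx: "x \<bullet> x = 1" unfolding x_def using v'o[of k k] k by simp
  define c where "c i = v i \<bullet> x" for i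
  define e where "e = 1 - (v k \<bullet> v' k)\<^sup>2"
  have ck: "(c k)\<^sup>2 = 1 - e" by (simp add: c_def e_def x_def)
  have csum: "(\<Sum>i\<in>{1..n}. (c i)\<^sup>2) = 1"
    using singular_parseval[OF A sysA xc xc] xx by (simp add: c_def power2_eq_square)
  \<comment> \<open>Bessel's inequality for the unit vector \<open>v i\<close> and the orthonormal
    pair \<open>v' i\<close>, \<open>v' k\<close>: whatever \<open>v i\<close> has along
    \<open>v' k\<close> is missing along \<open>v' i\<close>.\<close>
  have head_i: "(c i)\<^sup>2 \<le> 1 - (v i \<bullet> v' i)\<^sup>2" if i: "i \<in> {1..<k}" for i
  proof -
    have ic: "v i \<in> carrier_vec n" using i k by (intro vc) auto
    have "(\<Sum>j\<in>{i, k}. (v' j \<bullet> v i)\<^sup>2) \<le> (\<Sum>j\<in>{1..n}. (v' j \<bullet> v i)\<^sup>2)"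
      using i k by (intro sum_mono2) auto
    also have "\<dots> = v i \<bullet> v i"
      using singular_parseval[OF M sysM ic ic] by (simp add: power2_eq_square)
    also have "\<dots> = 1" using vo[of i i] i k by simp
    finally have "(v' i \<bullet> v i)\<^sup>2 + (v' k \<bullet> v i)\<^sup>2 \<le> 1" using i by simp
    moreover have "v' i \<bullet> v i = v i \<bullet> v' i" "v' k \<bullet> v i = v i \<bullet> v' k"
      using i k by (auto intro!: comm_scalar_prod[of _ n] vc v'c)
    ultimately show ?thesis by (simp add: c_def x_def)
  qed
  have s2: "s\<^sup>2 = (\<Sum>i\<in>{1..<k}. 1 - (v i \<bullet> v' i)\<^sup>2)"
  proof -
    have "0 \<le> (\<Sum>i\<in>{1..<k}. 1 - (v i \<bullet> v' i)\<^sup>2)"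
      by (intro sum_nonneg) (meson head_i order.trans zero_le_power2)
    then show ?thesis unfolding s_def by simp
  qed
  have snn: "0 \<le> s" unfolding s_def
    by (intro real_sqrt_ge_zero sum_nonneg) (meson head_i order.trans zero_le_power2)
  have head: "(\<Sum>i\<in>{1..<k}. (c i)\<^sup>2) \<le> s\<^sup>2" unfolding s2 by (intro sum_mono head_i)
  have split: "{1..n} = {1..<k} \<union> ({k} \<union> {k+1..n})" using k by auto
  have sum_split: "(\<Sum>i\<in>{1..n}. f i) = (\<Sum>i\<in>{1..<k}. f i) + (f k + (\<Sum>i\<in>{k+1..n}. f i))" for f :: "nat \<Rightarrow> real"
    unfolding split by (subst sum.union_disjoint, (auto)[3], subst sum.union_disjoint) auto
  have tail: "(\<Sum>i\<in>{k+1..n}. (c i)\<^sup>2) \<le> e"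
    using csum sum_split[of "\<lambda>i. (c i)\<^sup>2"] ck sum_nonneg[of "{1..<k}" "\<lambda>i. (c i)\<^sup>2"] by simp
  have e0: "0 \<le> e" using tail sum_nonneg[of "{k+1..n}" "\<lambda>i. (c i)\<^sup>2"] by simp
  \<comment> \<open>Three blocks: indices below \<open>k\<close> carry mass at most the square of
    \<open>s\<close> and cost at most \<open>\<sigma> 1\<close>; index \<open>k\<close> is kept
    exactly; the rest has mass at most \<open>e\<close> and costs at most
    \<open>\<sigma> (k + 1)\<close>.\<close>
  have energyA: "(A *\<^sub>v x) \<bullet> (A *\<^sub>v x) \<le> (\<sigma> 1)\<^sup>2 * s\<^sup>2 + (\<sigma> k)\<^sup>2 * (1 - e) + (\<sigma> (k + 1))\<^sup>2 * e"
  proof -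
    have le: "(\<Sum>i\<in>J. (\<sigma> i)\<^sup>2 * (c i)\<^sup>2) \<le> (\<sigma> m)\<^sup>2 * (\<Sum>i\<in>J. (c i)\<^sup>2)"
      if "J \<subseteq> {m..n}" "1 \<le> m" "m \<le> n" for m J
      unfolding sum_distrib_left
    proof (rule sum_mono)
      fix i assume "i \<in> J"
      then have "(\<sigma> i)\<^sup>2 \<le> (\<sigma> m)\<^sup>2" using that \<sigma>mono[of m i] \<sigma>nn[of i] by (intro power_mono) auto
      then show "(\<sigma> i)\<^sup>2 * (c i)\<^sup>2 \<le> (\<sigma> m)\<^sup>2 * (c i)\<^sup>2" by (rule mult_right_mono) simp
    qed
    have "(A *\<^sub>v x) \<bullet> (A *\<^sub>v x) = (\<Sum>i\<in>{1..n}. (\<sigma> i)\<^sup>2 * (c i)\<^sup>2)"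
      unfolding c_def by (rule singular_energy[OF A sysA xc])
    also have "\<dots> = (\<Sum>i\<in>{1..<k}. (\<sigma> i)\<^sup>2 * (c i)\<^sup>2) + ((\<sigma> k)\<^sup>2 * (1 - e) + (\<Sum>i\<in>{k+1..n}. (\<sigma> i)\<^sup>2 * (c i)\<^sup>2))"
      unfolding sum_split ck ..
    also have "\<dots> \<le> (\<sigma> 1)\<^sup>2 * s\<^sup>2 + ((\<sigma> k)\<^sup>2 * (1 - e) + (\<sigma> (k + 1))\<^sup>2 * e)"
    proof (intro add_mono order_refl)
      show "(\<Sum>i\<in>{1..<k}. (\<sigma> i)\<^sup>2 * (c i)\<^sup>2) \<le> (\<sigma> 1)\<^sup>2 * s\<^sup>2"
        by (rule order.trans[OF le mult_left_mono[OF head]]) (use k in auto)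
      show "(\<Sum>i\<in>{k+1..n}. (\<sigma> i)\<^sup>2 * (c i)\<^sup>2) \<le> (\<sigma> (k + 1))\<^sup>2 * e"
        by (rule order.trans[OF le mult_left_mono[OF tail]]) (use k in auto)
    qed
    finally show ?thesis by simp
  qed

  \<comment> \<open>\<open>y\<close> is the part of \<open>x\<close> in the row space and
    \<open>f\<close> the part in the kernel of \<open>A\<close>. Within \<open>y\<close>,
    \<open>h\<close> collects the indices below \<open>k\<close>, where the singular values may be
    large but the coefficients are controlled by \<open>s\<close>; \<open>g\<close> collects the
    others, where \<open>A\<close> stretches by at most \<open>\<sigma> k\<close>.\<close>
  define h where "h = comb n v I (\<lambda>i. if i < k then c i else 0)"
  define g where "g = comb n v I (\<lambda>i. if i < k then 0 else c i)"
  define y where "y = comb n v I c"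
  define f where "f = comb n v ({1..n} - I) c"
  have carr: "h \<in> carrier_vec n" "g \<in> carrier_vec n" "y \<in> carrier_vec n" "f \<in> carrier_vec n"
    by (simp_all add: h_def g_def y_def f_def)
  have "h + g = y" unfolding h_def g_def y_def comb_add by (intro comb_cong) auto
  have xyf: "x = y + f"
  proof -
    have "x = comb n v {1..n} c" unfolding c_def by (rule singular_expansion[OF A sysA xc])
    also have "{1..n} = I \<union> ({1..n} - I)" using I by auto
    also have "comb n v (I \<union> ({1..n} - I)) c = y + f"
      unfolding y_def f_def by (rule comb_union) (use I in auto)
    finally show ?thesis .
  qed
  have Af: "A *\<^sub>v f = 0\<^sub>v n"
  proof -
    have "A *\<^sub>v f = comb n (\<lambda>i. A *\<^sub>v v i) ({1..n} - I) c"
      unfolding f_def by (rule mult_mat_vec_comb) (use vc A in auto)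
    also have "A *\<^sub>v v i = 0\<^sub>v n" if "i \<in> {1..n} - I" for i
      using that \<sigma>nn[of i] by (intro singular_kernel[OF A sysA]) (auto simp: I_def)
    then have "comb n (\<lambda>i. A *\<^sub>v v i) ({1..n} - I) c = 0\<^sub>v n"
      by (intro eq_vecI) (auto simp: comb_def)
    finally show ?thesis .
  qed
  have Ay: "A *\<^sub>v y = A *\<^sub>v h + A *\<^sub>v g"
    using \<open>h + g = y\<close> mult_add_distrib_mat_vec[OF A carr(1,2)] by simp
  have Ax: "A *\<^sub>v x = A *\<^sub>v h + A *\<^sub>v g"
    unfolding Ay[symmetric] xyf using mult_add_distrib_mat_vec[OF A carr(3,4)] Af Ac[OF carr(3)] by simp
  have Ex: "E *\<^sub>v x = E *\<^sub>v y + E *\<^sub>v f"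
    unfolding xyf by (rule mult_add_distrib_mat_vec[OF E carr(3,4)])
  have crossx: "(A *\<^sub>v x) \<bullet> (E *\<^sub>v x)
      = (A *\<^sub>v h) \<bullet> (E *\<^sub>v x) + (A *\<^sub>v g) \<bullet> (E *\<^sub>v y) + (A *\<^sub>v g) \<bullet> (E *\<^sub>v f)"
  proof -
    have "(A *\<^sub>v x) \<bullet> (E *\<^sub>v x) = (A *\<^sub>v h) \<bullet> (E *\<^sub>v x) + (A *\<^sub>v g) \<bullet> (E *\<^sub>v x)"
      unfolding Ax by (rule add_scalar_prod_distrib) (use carr xc Ac Ec in auto)
    also have "(A *\<^sub>v g) \<bullet> (E *\<^sub>v x) = (A *\<^sub>v g) \<bullet> (E *\<^sub>v y) + (A *\<^sub>v g) \<bullet> (E *\<^sub>v f)"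
      unfolding Ex by (rule scalar_prod_add_distrib) (use carr Ac Ec in auto)
    finally show ?thesis by simp
  qed
  have Ah: "sqrt ((A *\<^sub>v h) \<bullet> (A *\<^sub>v h)) \<le> \<sigma> 1 * s"
  proof (rule real_le_lsqrt)
    have "(A *\<^sub>v h) \<bullet> (A *\<^sub>v h) = (\<Sum>i\<in>{1..<k}. (\<sigma> i)\<^sup>2 * (c i)\<^sup>2)"
      unfolding h_def energy_comb
      by (rule sum.mono_neutral_cong_right) (use I kI in \<open>auto simp: power2_eq_square\<close>)
    also have "\<dots> \<le> (\<Sum>i\<in>{1..<k}. (\<sigma> 1)\<^sup>2 * (c i)\<^sup>2)"
      using k \<sigma>mono[of 1] \<sigma>nn by (intro sum_mono mult_right_mono power_mono) auto
    also have "\<dots> \<le> (\<sigma> 1)\<^sup>2 * s\<^sup>2"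
      unfolding sum_distrib_left[symmetric] by (rule mult_left_mono[OF head]) simp
    finally show "(A *\<^sub>v h) \<bullet> (A *\<^sub>v h) \<le> (\<sigma> 1 * s)\<^sup>2" by (simp add: power_mult_distrib)
    show "0 \<le> \<sigma> 1 * s" using snn \<sigma>nn[of 1] k by simp
  qed
  have csumI: "(\<Sum>i\<in>I. (c i)\<^sup>2) \<le> 1"
    using csum sum_mono2[of "{1..n}" I "\<lambda>i. (c i)\<^sup>2"] I by simp
  have Ag: "sqrt ((A *\<^sub>v g) \<bullet> (A *\<^sub>v g)) \<le> \<sigma> k"
  proof (rule real_le_lsqrt)
    have "(A *\<^sub>v g) \<bullet> (A *\<^sub>v g) \<le> (\<Sum>i\<in>I. (\<sigma> k)\<^sup>2 * (c i)\<^sup>2)"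
      unfolding g_def energy_comb
    proof (rule sum_mono)
      fix i assume i: "i \<in> I"
      have "(\<sigma> i)\<^sup>2 \<le> (\<sigma> k)\<^sup>2" if "\<not> i < k"
        using that i I k \<sigma>mono[of k i] \<sigma>nn[of i] by (intro power_mono) auto
      then show "(\<sigma> i)\<^sup>2 * (if i < k then 0 else c i) * (if i < k then 0 else c i) \<le> (\<sigma> k)\<^sup>2 * (c i)\<^sup>2"
        by (auto simp: power2_eq_square[of "c i"] mult.assoc intro!: mult_right_mono)
    qed
    also have "\<dots> \<le> (\<sigma> k)\<^sup>2" unfolding sum_distrib_left[symmetric] using csumI by (simp add: mult_left_le)
    finally show "(A *\<^sub>v g) \<bullet> (A *\<^sub>v g) \<le> (\<sigma> k)\<^sup>2" .
  qed (use \<sigma>k in simp)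
  define F where "F = sqrt (f \<bullet> f)"
  have Fnn: "0 \<le> F" by (simp add: F_def scalar_prod_self_nonneg)
  \<comment> \<open>Since \<open>A\<close> annihilates \<open>f\<close>, one has
    \<open>M f = E f\<close>. The eigenvalue equation of \<open>x = v' k\<close> tested against
    \<open>f\<close> gives \<open>(\<sigma>' k)\<^sup>2 * F\<^sup>2\<close>, because
    \<open>x \<bullet> f = f \<bullet> f\<close>, and the same product is at most
    \<open>B * \<sigma>' k * F\<close>. Cancelling needs \<open>F\<close> nonzero.\<close>
  have F: "\<sigma> k * F \<le> 2 * B"
  proof (cases "F = 0")
    case False
    have yf: "y \<bullet> f = 0"
    proof -
      have "y \<bullet> f = (\<Sum>i\<in>I. c i * (v i \<bullet> f))"
        unfolding y_def by (rule scalar_prod_comb_left) (use vcI carr in auto)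
      also have "\<dots> = 0"
      proof (rule sum.neutral, rule ballI)
        fix i assume i: "i \<in> I"
        have "v i \<bullet> f = (\<Sum>j\<in>{1..n} - I. c j * (v i \<bullet> v j))"
          unfolding f_def by (rule scalar_prod_comb_right) (use vc vcI i in auto)
        also have "\<dots> = 0"
        proof (rule sum.neutral, rule ballI)
          fix j assume "j \<in> {1..n} - I"
          moreover from this i have "i \<noteq> j" "i \<in> {1..n}" using I by auto
          ultimately show "c j * (v i \<bullet> v j) = 0" using vo[of i j] by simp
        qed
        finally show "c i * (v i \<bullet> f) = 0" by simp
      qed
      finally show ?thesis .
    qed
    have "x \<bullet> f = f \<bullet> f"
      unfolding xyf using add_scalar_prod_distrib[OF carr(3,4,4)] yf by simp
    then have "(\<sigma>' k)\<^sup>2 * F\<^sup>2 = (M *\<^sub>v x) \<bullet> (M *\<^sub>v f)"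
      using singular_vector_gram[OF M sysM _ carr(4), of k] k
      by (simp add: x_def F_def scalar_prod_self_nonneg)
    also have "M *\<^sub>v f = E *\<^sub>v f" using Mx[OF carr(4)] Af Ec[OF carr(4)] by simp
    also have "(M *\<^sub>v x) \<bullet> (E *\<^sub>v f) \<le> B * sqrt ((M *\<^sub>v x) \<bullet> (M *\<^sub>v x)) * F"
      using B[OF Mc[OF xc] carr(4)] unfolding F_def by linarith
    also have "(M *\<^sub>v x) \<bullet> (M *\<^sub>v x) = (\<sigma>' k)\<^sup>2"
      using singular_vector_gram[OF M sysM _ xc, of k] k xx by (simp add: x_def)
    also have "sqrt ((\<sigma>' k)\<^sup>2) = \<sigma>' k" using \<sigma>'nn[of k] k by simp
    finally have "(\<sigma>' k * F) * (\<sigma>' k * F) \<le> (\<sigma>' k * F) * B" by (simp add: power2_eq_square algebra_simps)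
    moreover have "0 < \<sigma>' k * F" using False Fnn \<sigma>'k \<sigma>k by simp
    ultimately have "\<sigma>' k * F \<le> B" by (rule mult_left_le_imp_le)
    moreover have "\<sigma> k / 2 * F \<le> \<sigma>' k * F" using \<sigma>'k Fnn by (rule mult_right_mono)
    ultimately show ?thesis by simp
  qed (use nonneg in simp)

  have 1: "(A *\<^sub>v h) \<bullet> (E *\<^sub>v x) \<le> B * (\<sigma> 1 * s)"
  proof -
    have "(A *\<^sub>v h) \<bullet> (E *\<^sub>v x) \<le> B * sqrt ((A *\<^sub>v h) \<bullet> (A *\<^sub>v h))"
      using B[OF Ac[OF carr(1)] xc] xx by simp
    also have "\<dots> \<le> B * (\<sigma> 1 * s)" using Ah nonneg by (intro mult_left_mono) auto
    finally show ?thesis .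
  qed
  have 2: "(A *\<^sub>v g) \<bullet> (E *\<^sub>v y) \<le> T * \<sigma> k"
  proof -
    have "(A *\<^sub>v g) \<bullet> (E *\<^sub>v y) \<le> T * sqrt ((A *\<^sub>v g) \<bullet> (A *\<^sub>v g)) * sqrt (\<Sum>i\<in>I. (c i)\<^sup>2)"
      using cross[of "\<lambda>i. if i < k then 0 else c i" c] unfolding g_def y_def by linarith
    also have "\<dots> \<le> T * \<sigma> k * 1"
      using Ag csumI nonneg \<sigma>k by (intro mult_mono) (auto simp: scalar_prod_self_nonneg sum_nonneg)
    finally show ?thesis by simp
  qed
  \<comment> \<open>The smallness of \<open>F\<close> cancels the factor \<open>\<sigma> k\<close>
    and leaves a pure square of \<open>B\<close>.\<close>
  have 3: "(A *\<^sub>v g) \<bullet> (E *\<^sub>v f) \<le> 2 * B\<^sup>2"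
  proof -
    have "(A *\<^sub>v g) \<bullet> (E *\<^sub>v f) \<le> B * sqrt ((A *\<^sub>v g) \<bullet> (A *\<^sub>v g)) * F"
      using B[OF Ac[OF carr(2)] carr(4)] unfolding F_def by linarith
    also have "\<dots> \<le> B * \<sigma> k * F" using Ag nonneg Fnn by (intro mult_right_mono mult_left_mono)
    also have "\<dots> \<le> B * (2 * B)" unfolding mult.assoc using F nonneg by (intro mult_left_mono) auto
    finally show ?thesis by (simp add: power2_eq_square)
  qed
  have 4: "(E *\<^sub>v x) \<bullet> (E *\<^sub>v x) \<le> B\<^sup>2"
  proof -
    define N where "N = sqrt ((E *\<^sub>v x) \<bullet> (E *\<^sub>v x))"
    have N2: "N * N = (E *\<^sub>v x) \<bullet> (E *\<^sub>v x)" unfolding N_def by (simp add: scalar_prod_self_nonneg)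
    have "N \<ge> 0" unfolding N_def by (simp add: scalar_prod_self_nonneg)
    have "N * N \<le> B * N" using B[OF Ec[OF xc] xc] xx unfolding N2 N_def by simp
    then have "N \<le> B" using nonneg \<open>N \<ge> 0\<close> by (cases "N = 0") auto
    then have "N\<^sup>2 \<le> B\<^sup>2" using \<open>N \<ge> 0\<close> by (rule power_mono)
    then show ?thesis by (simp add: power2_eq_square N2)
  qed
  have Mxx: "(\<sigma>' k)\<^sup>2 = (A *\<^sub>v x) \<bullet> (A *\<^sub>v x) + 2 * ((A *\<^sub>v x) \<bullet> (E *\<^sub>v x)) + (E *\<^sub>v x) \<bullet> (E *\<^sub>v x)"
  proof -
    have "(\<sigma>' k)\<^sup>2 = (M *\<^sub>v x) \<bullet> (M *\<^sub>v x)"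
      using singular_vector_gram[OF M sysM _ xc, of k] k xx by (simp add: x_def)
    also have "\<dots> = (A *\<^sub>v x + E *\<^sub>v x) \<bullet> (A *\<^sub>v x) + (A *\<^sub>v x + E *\<^sub>v x) \<bullet> (E *\<^sub>v x)"
      unfolding Mx[OF xc] by (rule scalar_prod_add_distrib) (use Ac[OF xc] Ec[OF xc] in auto)
    also have "\<dots> = (A *\<^sub>v x) \<bullet> (A *\<^sub>v x) + (E *\<^sub>v x) \<bullet> (A *\<^sub>v x) + ((A *\<^sub>v x) \<bullet> (E *\<^sub>v x) + (E *\<^sub>v x) \<bullet> (E *\<^sub>v x))"
      using Ac[OF xc] Ec[OF xc] by (simp add: add_scalar_prod_distrib)
    also have "(E *\<^sub>v x) \<bullet> (A *\<^sub>v x) = (A *\<^sub>v x) \<bullet> (E *\<^sub>v x)"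
      by (rule comm_scalar_prod[OF Ec[OF xc] Ac[OF xc]])
    finally show ?thesis by simp
  qed
  have "(\<sigma> k - T)\<^sup>2 \<le> (\<sigma>' k)\<^sup>2" using lower small nonneg by (intro power_mono) auto
  then have "(\<sigma> k)\<^sup>2 - 2 * T * \<sigma> k \<le> (\<sigma>' k)\<^sup>2"
    using zero_le_power2[of T] by (simp only: power2_diff mult_ac)
  \<comment> \<open>The \<open>4 * T * \<sigma> k\<close> of the conclusion is half from the lower
    bound on \<open>\<sigma>' k\<close> and half from the doubled cross term; the 5 in front of the
    square of \<open>B\<close> is \<open>2 * 2 + 1\<close>.\<close>
  also have "\<dots> \<le> (\<sigma> 1)\<^sup>2 * s\<^sup>2 + (\<sigma> k)\<^sup>2 * (1 - e) + (\<sigma> (k + 1))\<^sup>2 * e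
      + 2 * (B * (\<sigma> 1 * s) + T * \<sigma> k + 2 * B\<^sup>2) + B\<^sup>2"
    unfolding Mxx crossx using energyA 1 2 3 4 by (intro add_mono mult_left_mono) auto
  finally have "((\<sigma> k)\<^sup>2 - (\<sigma> (k + 1))\<^sup>2) * e
      \<le> (\<sigma> 1)\<^sup>2 * s\<^sup>2 + 2 * B * \<sigma> 1 * s + 4 * T * \<sigma> k + 5 * B\<^sup>2"
    by (simp add: algebra_simps)
  moreover have "\<sigma> k * (\<sigma> k - \<sigma> (k + 1)) * e \<le> ((\<sigma> k)\<^sup>2 - (\<sigma> (k + 1))\<^sup>2) * e"
  proof (rule mult_right_mono[OF _ e0])
    have "0 \<le> \<sigma> (k + 1) * (\<sigma> k - \<sigma> (k + 1))" using gap \<sigma>nn[of "k + 1"] k by simp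
    then show "\<sigma> k * (\<sigma> k - \<sigma> (k + 1)) \<le> (\<sigma> k)\<^sup>2 - (\<sigma> (k + 1))\<^sup>2"
      by (simp add: power2_eq_square algebra_simps)
  qed
  ultimately show ?thesis unfolding e_def by linarith
qed

subsection \<open>Rank, angles and the random event\<close>

context vec_space
begin

text \<open>Pairing a vanishing combination with one of its vectors isolates that coefficient. Over
  a general field \<open>x \<bullet> x\<close> may vanish for nonzero \<open>x\<close>, hence the
  form of the last assumption.\<close>

lemma lin_indpt_orthogonal:
  fixes W :: "'a vec set"
  assumes W: "finite W" "W \<subseteq> carrier_vec n"
    and orth: "\<And>x y. x \<in> W \<Longrightarrow> y \<in> W \<Longrightarrow> x \<noteq> y \<Longrightarrow> x \<bullet> y = 0"
    and nz: "\<And>x. x \<in> W \<Longrightarrow> x \<bullet> x \<noteq> 0"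
  shows "lin_indpt W"
proof
  assume "lin_dep W"
  then obtain a w where a: "lincomb a W = 0\<^sub>v n" and w: "w \<in> W" "a w \<noteq> 0"
    using finite_lin_dep[OF W(1)] W(2) by auto
  have wc: "w \<in> carrier_vec n" using w W by blast
  have "0 = lincomb a W \<bullet> w" using wc by (simp add: a)
  also have "\<dots> = (\<Sum>i\<in>{0..<n}. \<Sum>x\<in>W. a x * (x $ i * w $ i))"
    using wc W by (simp add: scalar_prod_def lincomb_index sum_distrib_right mult.assoc)
  also have "\<dots> = (\<Sum>x\<in>W. \<Sum>i\<in>{0..<n}. a x * (x $ i * w $ i))" by (rule sum.swap)
  also have "\<dots> = (\<Sum>x\<in>W. a x * (x \<bullet> w))"
    using wc by (simp add: scalar_prod_def sum_distrib_left)
  also have "\<dots> = (\<Sum>x\<in>W. if x = w then a w * (w \<bullet> w) else 0)"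
    by (intro sum.cong refl) (use orth w in auto)
  also have "\<dots> = a w * (w \<bullet> w)" using w W by simp
  finally show False using w nz by simp
qed

text \<open>The images are distinct, since equal ones would be orthogonal to themselves, and they
  are linearly independent inside the column space. Applied to the \<open>v i\<close> with
  \<open>\<sigma> i > 0\<close>, this limits the size of the compression to
  \<open>r\<close>.\<close>

lemma card_orthogonal_image_le_rank:
  assumes A: "A \<in> carrier_mat n nc" and J: "finite J"
    and x: "\<And>j. j \<in> J \<Longrightarrow> x j \<in> carrier_vec nc"
    and orth: "\<And>i j. i \<in> J \<Longrightarrow> j \<in> J \<Longrightarrow> i \<noteq> j \<Longrightarrow> (A *\<^sub>v x i) \<bullet> (A *\<^sub>v x j) = 0"
    and nz: "\<And>j. j \<in> J \<Longrightarrow> (A *\<^sub>v x j) \<bullet> (A *\<^sub>v x j) \<noteq> 0"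
  shows "card J \<le> rank A"
proof -
  define W where "W = (\<lambda>j. A *\<^sub>v x j) ` J"
  have inj: "inj_on (\<lambda>j. A *\<^sub>v x j) J" by (rule inj_onI) (metis orth nz)
  have W: "finite W" "W \<subseteq> carrier_vec n" unfolding W_def using J A x by auto
  have "lin_indpt W" by (rule lin_indpt_orthogonal[OF W]) (use orth nz in \<open>auto simp: W_def\<close>)
  have cols: "set (cols A) \<subseteq> carrier_vec n" using A cols_dim by blast
  have sub: "W \<subseteq> span (set (cols A))"
    using col_space_eq[OF A] A x unfolding col_space_def W_def by auto
  have sm: "submodule class_ring (span (set (cols A))) V"
    using cols by (simp add: span_is_submodule)
  have "LinearCombinations.module.lin_indpt class_ring (span_vs (set (cols A))) W"
    using span_li_not_depend(2)[OF sub sm] \<open>lin_indpt W\<close> by simp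
  moreover have "vectorspace class_ring (span_vs (set (cols A)))"
    using cols span_is_subspace subspace_is_vs by auto
  ultimately have "card W \<le> vectorspace.dim class_ring (span_vs (set (cols A)))"
    using vectorspace.li_le_dim(2)[OF _ fin_dim_span_cols[OF A]] sub by simp
  then show ?thesis unfolding rank_def W_def by (simp add: card_image[OF inj])
qed

end

lemma sin_line_angle_squared:
  fixes x y :: "real vec"
  assumes "x \<in> carrier_vec n" "y \<in> carrier_vec n" "x \<bullet> x = 1" "y \<bullet> y = 1"
  shows "(sin (line_angle x y))\<^sup>2 = 1 - (x \<bullet> y)\<^sup>2"
proof -
  have "\<bar>x \<bullet> y\<bar> \<le> 1" using scalar_prod_le_norms[OF assms(1,2)] assms by simp
  then show ?thesis unfolding line_angle_def using assms(3,4)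
    by (simp add: sin_squared_eq)
qed

lemma scalar_prod_mat_bilinear:
  fixes x y :: "real vec"
  assumes "x \<in> carrier_vec n" "y \<in> carrier_vec n"
  shows "x \<bullet> (Matrix.mat n n f *\<^sub>v y) = (\<Sum>k<n. \<Sum>l<n. x $ k * f (k, l) * y $ l)"
  using assms
  by (simp add: scalar_prod_def lessThan_atLeast0 sum_distrib_left mult.assoc)

section \<open>The two exceptional events and their probabilities\<close>

text \<open>The compression bound with the standard basis on both sides. The choice
  \<open>t = 10 * sqrt n\<close> gives the exponent \<open>- 50 * n\<close>, which beats the net
  size, at most \<open>exp (36 * n)\<close>, with \<open>14 * n\<close> to spare.\<close>

lemma bernoulli_operator_norm:
  assumes n: "n \<ge> 1"
  shows "measure_pmf.prob (Pi_pmf ({0..<n} \<times> {0..<n}) 0 (\<lambda>_. pmf_of_set {-1, 1 :: real}))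
      {f. \<exists>x\<in>carrier_vec n. \<exists>y\<in>carrier_vec n.
        \<bar>x \<bullet> (Matrix.mat n n f *\<^sub>v y)\<bar> > 20 * sqrt (real n) * sqrt (x \<bullet> x) * sqrt (y \<bullet> y)}
    \<le> 2 / real n"
proof -
  define p :: "nat \<Rightarrow> nat \<Rightarrow> real" where "p i k = (if i = k then 1 else 0)" for i k
  define t where "t = 10 * sqrt (real n)"
  have p: "(\<Sum>k<n. p i k * p j k) = (if i = j then 1 else 0)" if "i \<in> {0..<n}" "j \<in> {0..<n}" for i j
    using that by (simp add: p_def if_distrib[of "\<lambda>x. x * _"] cong: if_cong)
  have t: "t > 0" using n by (simp add: t_def)
  have W: "(\<Sum>k<n. \<Sum>l<n. p i k * f (k, l) * p j l) = f (i, j)" if "i < n" "j < n" for i j f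
  proof -
    have "(\<Sum>k<n. \<Sum>l<n. p i k * f (k, l) * p j l) = (\<Sum>k<n. p i k * (\<Sum>l<n. p j l * f (k, l)))"
      by (simp add: sum_distrib_left mult_ac)
    also have "\<dots> = f (i, j)"
      using that by (simp add: p_def if_distrib[of "\<lambda>x. x * _"] cong: if_cong)
    finally show ?thesis .
  qed
  have "{f. \<exists>x\<in>carrier_vec n. \<exists>y\<in>carrier_vec n.
        \<bar>x \<bullet> (Matrix.mat n n f *\<^sub>v y)\<bar> > 20 * sqrt (real n) * sqrt (x \<bullet> x) * sqrt (y \<bullet> y)}
    \<subseteq> {f. \<exists>a b. \<bar>bilin {0..<n} (\<lambda>i j. \<Sum>k<n. \<Sum>l<n. p i k * f (k, l) * p j l) a b\<bar>
        > 2 * t * L2_set a {0..<n} * L2_set b {0..<n}}"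
  proof clarify
    fix f :: "nat \<times> nat \<Rightarrow> real" and x y :: "real vec"
    assume xy: "x \<in> carrier_vec n" "y \<in> carrier_vec n"
      and gt: "20 * sqrt (real n) * sqrt (x \<bullet> x) * sqrt (y \<bullet> y) < \<bar>x \<bullet> (Matrix.mat n n f *\<^sub>v y)\<bar>"
    have "bilin {0..<n} (\<lambda>i j. \<Sum>k<n. \<Sum>l<n. p i k * f (k, l) * p j l) (($) x) (($) y)
        = x \<bullet> (Matrix.mat n n f *\<^sub>v y)"
      unfolding bilin_def scalar_prod_mat_bilinear[OF xy] lessThan_atLeast0[symmetric]
      by (intro sum.cong refl) (simp add: W)
    moreover have "L2_set (($) x) {0..<n} = sqrt (x \<bullet> x)" "L2_set (($) y) {0..<n} = sqrt (y \<bullet> y)"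
      using xy by (simp_all add: L2_set_def scalar_prod_def power2_eq_square)
    ultimately show "\<exists>a b. \<bar>bilin {0..<n} (\<lambda>i j. \<Sum>k<n. \<Sum>l<n. p i k * f (k, l) * p j l) a b\<bar>
        > 2 * t * L2_set a {0..<n} * L2_set b {0..<n}"
      using gt by (intro exI[of _ "($) x"] exI[of _ "($) y"]) (simp add: t_def)
  qed
  then have "measure_pmf.prob (Pi_pmf ({0..<n} \<times> {0..<n}) 0 (\<lambda>_. pmf_of_set {-1, 1 :: real}))
      {f. \<exists>x\<in>carrier_vec n. \<exists>y\<in>carrier_vec n.
        \<bar>x \<bullet> (Matrix.mat n n f *\<^sub>v y)\<bar> > 20 * sqrt (real n) * sqrt (x \<bullet> x) * sqrt (y \<bullet> y)}
    \<le> 2 ^ (36 * card {0..<n}) * (2 * exp (- t\<^sup>2 / 2))"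
    by (intro order.trans[OF measure_pmf.finite_measure_mono prob_compression_norm[OF _ t p p]]) auto
  also have "\<dots> \<le> exp 1 ^ (36 * n) * (2 * exp (- 50 * real n))"
  proof (intro mult_mono)
    have "(2 :: real) \<le> exp 1" using exp_ge_add_one_self[of 1] by simp
    then show "(2 :: real) ^ (36 * card {0..<n}) \<le> exp 1 ^ (36 * n)"
      by (simp add: power_mono)
  qed (auto simp: t_def power_mult_distrib)
  also have "\<dots> = 2 * exp (- 14 * real n)"
    by (simp flip: exp_of_nat_mult exp_add)
  also have "\<dots> \<le> 2 * exp (- real n)" by simp
  also have "\<dots> \<le> 2 / real n"
  proof -
    have "real n \<le> exp (real n)" using exp_ge_add_one_self[of "real n"] by linarith
    then show ?thesis using n by (simp add: exp_minus field_simps)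
  qed
  finally show ?thesis .
qed

text \<open>With \<open>t = 13 * sqrt (r * ln n)\<close> the exponent is
  \<open>- 84.5 * r * ln n\<close>. Because \<open>ln n \<ge> 2/3\<close>, the net costs at most
  \<open>54 * r * ln n\<close>; what is left exceeds \<open>ln n\<close> as
  \<open>r \<ge> 1\<close>, so the failure probability is \<open>O(1/n)\<close> even for
  \<open>r = 1\<close>.\<close>

lemma bernoulli_compression_norm:
  fixes u v :: "'i \<Rightarrow> real vec"
  assumes n: "n \<ge> 2" and J: "finite J" "card J \<le> r" and r: "r \<ge> 1"
    and u: "\<And>i. i \<in> J \<Longrightarrow> u i \<in> carrier_vec n"
      "\<And>i j. i \<in> J \<Longrightarrow> j \<in> J \<Longrightarrow> u i \<bullet> u j = (if i = j then 1 else 0)"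
    and v: "\<And>i. i \<in> J \<Longrightarrow> v i \<in> carrier_vec n"
      "\<And>i j. i \<in> J \<Longrightarrow> j \<in> J \<Longrightarrow> v i \<bullet> v j = (if i = j then 1 else 0)"
  shows "measure_pmf.prob (Pi_pmf ({0..<n} \<times> {0..<n}) 0 (\<lambda>_. pmf_of_set {-1, 1 :: real}))
      {f. \<exists>a b. \<bar>bilin J (\<lambda>i j. u i \<bullet> (Matrix.mat n n f *\<^sub>v v j)) a b\<bar>
        > 26 * sqrt (real r * ln (real n)) * L2_set a J * L2_set b J}
    \<le> 2 / real n"
proof -
  define t where "t = 13 * sqrt (real r * ln (real n))"
  have "ln 2 \<le> ln (real n)" using n by simp
  then have L: "2 / 3 \<le> ln (real n)" using ln2_ge_two_thirds by linarith
  then have rL: "real r * ln (real n) > 0" using r by simp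
  then have t: "t > 0" by (simp add: t_def)
  have dot: "(\<Sum>k<n. x $ k * y $ k) = x \<bullet> y" if "y \<in> carrier_vec n" for x y :: "real vec"
    using that by (simp add: scalar_prod_def lessThan_atLeast0)
  have bil: "bilin J (\<lambda>i j. \<Sum>k<n. \<Sum>l<n. u i $ k * f (k, l) * v j $ l) a b
      = bilin J (\<lambda>i j. u i \<bullet> (Matrix.mat n n f *\<^sub>v v j)) a b" for f a b
    unfolding bilin_def by (intro sum.cong refl) (simp add: scalar_prod_mat_bilinear u v)
  have "measure_pmf.prob (Pi_pmf ({0..<n} \<times> {0..<n}) 0 (\<lambda>_. pmf_of_set {-1, 1 :: real}))
      {f. \<exists>a b. \<bar>bilin J (\<lambda>i j. \<Sum>k<n. \<Sum>l<n. u i $ k * f (k, l) * v j $ l) a b\<bar>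
        > 2 * t * L2_set a J * L2_set b J}
      \<le> 2 ^ (36 * card J) * (2 * exp (- t\<^sup>2 / 2))"
    using J t by (intro prob_compression_norm) (auto simp: dot u v)
  also have "\<dots> \<le> exp 1 ^ (36 * r) * (2 * exp (- (169 / 2) * (real r * ln (real n))))"
  proof (intro mult_mono)
    have "(2 :: real) ^ (36 * card J) \<le> 2 ^ (36 * r)" using J by (intro power_increasing) auto
    also have "(2 :: real) \<le> exp 1" using exp_ge_add_one_self[of 1] by simp
    then have "(2 :: real) ^ (36 * r) \<le> exp 1 ^ (36 * r)" by (simp add: power_mono)
    finally show "(2 :: real) ^ (36 * card J) \<le> exp 1 ^ (36 * r)" .
  qed (use rL in \<open>auto simp: t_def power_mult_distrib\<close>)
  also have "\<dots> = 2 * exp (36 * real r - 169 / 2 * (real r * ln (real n)))"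
    by (simp add: exp_diff exp_minus field_simps flip: exp_of_nat_mult exp_add)
  also have "\<dots> \<le> 2 * exp (- ln (real n))"
  proof -
    have "36 * real r \<le> real r * (54 * ln (real n))"
      using mult_left_mono[of 36 "54 * ln (real n)" "real r"] L by (simp add: mult.commute)
    moreover have "ln (real n) \<le> real r * ln (real n)"
      using mult_right_mono[of 1 "real r" "ln (real n)"] r L by simp
    ultimately have "36 * real r - 169 / 2 * (real r * ln (real n)) \<le> - ln (real n)"
      using rL by linarith
    then show ?thesis by simp
  qed
  also have "\<dots> = 2 / real n" using n by (simp add: exp_minus field_simps)
  finally show ?thesis by (simp add: bil t_def)
qed

section \<open>From the deterministic estimate to the maximum of five terms\<close>

text \<open>Real arithmetic with \<open>sn\<close> for \<open>sqrt n\<close> and \<open>L\<close>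
  for \<open>sqrt (r * ln n)\<close>. Each term of the estimate is dominated by a member of the
  maximum. If \<open>L\<close> is too large for the estimate to apply, the claim is trivial because
  a squared sine is at most 1.\<close>

lemma perturbation_bound_as_max:
  fixes e s s1 sk d sn L :: real
  assumes d: "0 < d" "d \<le> sk" and s: "0 \<le> s" "0 \<le> s1" and e: "e \<le> 1" and sn: "0 \<le> sn" and L: "0 \<le> L"
    and main: "2 * (26 * L) \<le> sk \<Longrightarrow>
      sk * d * e \<le> s1\<^sup>2 * s\<^sup>2 + 2 * (20 * sn) * s1 * s + 4 * (26 * L) * sk + 5 * (20 * sn)\<^sup>2"
  shows "e \<le> 2145 * Max {L / d, sn\<^sup>2 / (sk * d), sn / sk, s1\<^sup>2 * s\<^sup>2 / (sk * d),
      (s1 + sn) * (sk + sn) * s / (sk * d)}"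
proof -
  define m where "m = Max {L / d, sn\<^sup>2 / (sk * d), sn / sk, s1\<^sup>2 * s\<^sup>2 / (sk * d),
      (s1 + sn) * (sk + sn) * s / (sk * d)}"
  have m: "L / d \<le> m" "sn\<^sup>2 / (sk * d) \<le> m" "s1\<^sup>2 * s\<^sup>2 / (sk * d) \<le> m"
    "(s1 + sn) * (sk + sn) * s / (sk * d) \<le> m"
    unfolding m_def by (rule Max_ge; simp)+
  have sk: "0 < sk" using d by linarith
  have m0: "0 \<le> m" using m(1) L d by (meson divide_nonneg_pos order.trans)
  have "e \<le> 2145 * m"
  proof (cases "2 * (26 * L) \<le> sk")
    case True
    have D: "0 < sk * d" using sk d by simp
    have "s1 * sn \<le> (s1 + sn) * (sk + sn)"
      using s sn sk by (intro mult_mono) auto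
    then have "s1 * sn * s \<le> (s1 + sn) * (sk + sn) * s" using s by (intro mult_right_mono)
    also have "\<dots> \<le> m * (sk * d)" using m(4) D by (simp add: pos_divide_le_eq)
    finally have a: "s1 * sn * s \<le> m * (sk * d)" .
    have b: "s1\<^sup>2 * s\<^sup>2 \<le> m * (sk * d)" "sn\<^sup>2 \<le> m * (sk * d)"
      using m D by (simp_all add: pos_divide_le_eq)
    have "L \<le> m * d" using m(1) d by (simp add: pos_divide_le_eq)
    then have c: "L * sk \<le> m * (sk * d)" using mult_right_mono[of L "m * d" sk] sk by (simp add: mult_ac)
    have "e * (sk * d) \<le> s1\<^sup>2 * s\<^sup>2 + 40 * (s1 * sn * s) + 104 * (L * sk) + 2000 * sn\<^sup>2"
      using main[OF True] by (simp add: algebra_simps power_mult_distrib)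
    \<comment> \<open>The constant is the sum of the four coefficients,
      \<open>1 + 40 + 104 + 2000 = 2145\<close>.\<close>
    also have "\<dots> \<le> (2145 * m) * (sk * d)" using a b c by (simp add: algebra_simps)
    finally show ?thesis using D by (rule mult_right_le_imp_le)
  next
    case False
    \<comment> \<open>Here \<open>d \<le> sk < 52 * L\<close>, so the first member of the maximum
      already exceeds 1/52.\<close>
    then have "1 \<le> 52 * (L / d)" using d by (simp add: field_simps)
    then show ?thesis using e m(1) m0 by linarith
  qed
  then show ?thesis unfolding m_def .
qed

theorem theorem9:
  fixes \<alpha>1 \<alpha>2 :: real and k :: nat
  assumes "\<alpha>1 > 0" and "\<alpha>2 > 0" and "k \<ge> 1"
  shows "\<exists>C>0. \<exists>p :: nat \<Rightarrow> real. p \<longlonglongrightarrow> 0 \<and>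
    (\<forall>n>k. \<forall>(A :: real mat) (\<sigma> :: nat \<Rightarrow> real) (v :: nat \<Rightarrow> real vec) (\<delta> :: nat \<Rightarrow> real) (r :: nat).
       A \<in> carrier_mat n n \<longrightarrow>
       right_singular_system A \<sigma> v \<longrightarrow>
       (\<forall>i\<in>{1..k}. \<delta> i = \<sigma> i - \<sigma> (i + 1)) \<longrightarrow>
       (\<forall>i\<in>{1..k}. \<delta> i > 0) \<longrightarrow>
       r = vec_space.rank n A \<longrightarrow>
       real r \<le> real n powr (1 - \<alpha>1) \<longrightarrow>
       \<sigma> 1 \<le> real n powr \<alpha>2 \<longrightarrow>
       measure_pmf.prob (bernoulli_matrix_pmf n)
         {E. \<forall>(\<sigma>' :: nat \<Rightarrow> real) (v' :: nat \<Rightarrow> real vec). right_singular_system (A + E) \<sigma>' v' \<longrightarrow>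
              (let \<epsilon> = (\<lambda>i. sin (line_angle (v i) (v' i)));
                   s = sqrt (\<Sum>i\<in>{1..<k}. (\<epsilon> i)\<^sup>2)
               in (\<epsilon> k)\<^sup>2 \<le> C * Max {
                    sqrt (real r * ln (real n)) / \<delta> k,
                    real n / (\<sigma> k * \<delta> k),
                    sqrt (real n) / \<sigma> k,
                    (\<sigma> 1)\<^sup>2 * s\<^sup>2 / (\<sigma> k * \<delta> k),
                    (\<sigma> 1 + sqrt (real n)) * (\<sigma> k + sqrt (real n)) * s / (\<sigma> k * \<delta> k)})}
       \<ge> 1 - p n)"
proof -
  \<comment> \<open>Two exceptional events, each of probability at most
    \<open>2 / n\<close>.\<close>
  define p :: "nat \<Rightarrow> real" where "p n = 4 / real n" for n
  have p: "p \<longlonglongrightarrow> 0"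
    unfolding p_def by (rule real_tendsto_divide_at_top[OF tendsto_const filterlim_real_sequentially])
  show ?thesis
  proof (rule exI[of _ 2145], rule conjI[OF _ exI[of _ p]], simp, rule conjI[OF p], intro allI impI)
    fix n :: nat and A :: "real mat" and \<sigma> :: "nat \<Rightarrow> real" and v :: "nat \<Rightarrow> real vec"
      and \<delta> :: "nat \<Rightarrow> real" and r :: nat
    assume kn: "k < n" and A: "A \<in> carrier_mat n n" and sysA: "right_singular_system A \<sigma> v"
      and \<delta>: "\<forall>i\<in>{1..k}. \<delta> i = \<sigma> i - \<sigma> (i + 1)" and \<delta>pos: "\<forall>i\<in>{1..k}. \<delta> i > 0"
      and r: "r = vec_space.rank n A"
    define J where "J = {i. 1 \<le> i \<and> i \<le> n \<and> 0 < \<sigma> i}"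
    define u where "u = (\<lambda>i. (1 / \<sigma> i) \<cdot>\<^sub>v (A *\<^sub>v v i))"
    define P where "P = Pi_pmf ({0..<n} \<times> {0..<n}) 0 (\<lambda>_. pmf_of_set {-1, 1 :: real})"
    let ?Good = "{E. \<forall>(\<sigma>' :: nat \<Rightarrow> real) (v' :: nat \<Rightarrow> real vec). right_singular_system (A + E) \<sigma>' v' \<longrightarrow>
              (let \<epsilon> = (\<lambda>i. sin (line_angle (v i) (v' i)));
                   s = sqrt (\<Sum>i\<in>{1..<k}. (\<epsilon> i)\<^sup>2)
               in (\<epsilon> k)\<^sup>2 \<le> 2145 * Max {
                    sqrt (real r * ln (real n)) / \<delta> k,
                    real n / (\<sigma> k * \<delta> k),
                    sqrt (real n) / \<sigma> k,
                    (\<sigma> 1)\<^sup>2 * s\<^sup>2 / (\<sigma> k * \<delta> k),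
                    (\<sigma> 1 + sqrt (real n)) * (\<sigma> k + sqrt (real n)) * s / (\<sigma> k * \<delta> k)})}"
    define Good where "Good = ?Good"
    \<comment> \<open>Both events involve only \<open>E\<close> and the fixed singular vectors of
      \<open>A\<close>. Outside them the estimate holds for every singular system of
      \<open>A + E\<close> at once, so no choice of \<open>v'\<close> as a function of
      \<open>E\<close> has to be made.\<close>
    define Bad1 where "Bad1 = {f. \<exists>x\<in>carrier_vec n. \<exists>y\<in>carrier_vec n.
        \<bar>x \<bullet> (Matrix.mat n n f *\<^sub>v y)\<bar> > 20 * sqrt (real n) * sqrt (x \<bullet> x) * sqrt (y \<bullet> y)}"
    define Bad2 where "Bad2 = {f. \<exists>a b. \<bar>bilin J (\<lambda>i j. u i \<bullet> (Matrix.mat n n f *\<^sub>v v j)) a b\<bar>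
        > 26 * sqrt (real r * ln (real n)) * L2_set a J * L2_set b J}"
    note vc = singular_vector_carrier[OF A sysA] and vo = singular_vector_orthonormal[OF A sysA]
    note \<sigma>nn = singular_value_nonneg[OF A sysA] and \<sigma>mono = singular_value_antimono[OF A sysA]
    have dk: "\<delta> k = \<sigma> k - \<sigma> (k + 1)" "\<delta> k > 0" using \<delta> \<delta>pos assms(3) by auto
    have dk_le: "\<delta> k \<le> \<sigma> k" using dk \<sigma>nn[of "k + 1"] kn by simp
    then have \<sigma>k: "\<sigma> k > 0" using dk by linarith
    have J: "finite J" "J \<subseteq> {1..n}" unfolding J_def by (auto intro: finite_subset[of _ "{1..n}"])
    have vJ: "v i \<in> carrier_vec n" if "i \<in> J" for i using that J vc by blast
    have voJ: "v i \<bullet> v j = (if i = j then 1 else 0)" if "i \<in> J" "j \<in> J" for i j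
      using that J vo by blast
    have AvJ: "A *\<^sub>v v i \<in> carrier_vec n" if "i \<in> J" for i using A vJ[OF that] by simp
    have gram: "(A *\<^sub>v v i) \<bullet> (A *\<^sub>v v j) = (if i = j then (\<sigma> i)\<^sup>2 else 0)" if "i \<in> J" "j \<in> J" for i j
      using singular_vector_gram[OF A sysA, of i "v j"] that J vJ voJ by auto
    have uJ: "u i \<in> carrier_vec n" if "i \<in> J" for i using AvJ[OF that] by (simp add: u_def)
    have uo: "u i \<bullet> u j = (if i = j then 1 else 0)" if ij: "i \<in> J" "j \<in> J" for i j
    proof -
      have "u i \<bullet> u j = (1 / \<sigma> i) * ((1 / \<sigma> j) * ((A *\<^sub>v v i) \<bullet> (A *\<^sub>v v j)))"
        unfolding u_def using AvJ[OF ij(1)] AvJ[OF ij(2)] by simp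
      moreover have "\<sigma> i \<noteq> 0" using ij by (simp add: J_def)
      ultimately show ?thesis using gram[OF ij] by (auto simp: power2_eq_square)
    qed
    have card_J: "card J \<le> r"
      unfolding r
      by (rule vec_space.card_orthogonal_image_le_rank[OF A J(1) vJ])
        (auto simp: gram, auto simp: J_def)
    \<comment> \<open>The positive gap forces \<open>\<sigma> k > 0\<close>, hence positive rank,
      which the bound for \<open>Bad2\<close> requires.\<close>
    have "k \<in> J" using \<sigma>k assms(3) kn by (simp add: J_def)
    then have "card J \<ge> 1" using J(1) by (metis One_nat_def Suc_leI card_gt_0_iff empty_iff)
    then have r1: "r \<ge> 1" using card_J by linarith
    have n2: "n \<ge> 2" using kn assms(3) by linarith
    have L0: "0 \<le> sqrt (real r * ln (real n))" using n2 by simp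
    have good: "Matrix.mat n n f \<in> Good" if f1: "f \<notin> Bad1" and f2: "f \<notin> Bad2" for f
    proof -
      define E where "E = Matrix.mat n n f"
      have E: "E \<in> carrier_mat n n" by (simp add: E_def)
      have B: "\<bar>x \<bullet> (E *\<^sub>v y)\<bar> \<le> 20 * sqrt (real n) * sqrt (x \<bullet> x) * sqrt (y \<bullet> y)"
        if "x \<in> carrier_vec n" "y \<in> carrier_vec n" for x y
        using f1 that unfolding Bad1_def E_def by (auto simp: not_less)
      have T: "\<bar>bilin J (\<lambda>i j. u i \<bullet> (E *\<^sub>v v j)) a b\<bar>
          \<le> 26 * sqrt (real r * ln (real n)) * L2_set a J * L2_set b J" for a b
        using f2 unfolding Bad2_def E_def by (auto simp: not_less)
      have concl: "(sin (line_angle (v k) (v' k)))\<^sup>2 \<le> 2145 * Max {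
                    sqrt (real r * ln (real n)) / \<delta> k,
                    real n / (\<sigma> k * \<delta> k),
                    sqrt (real n) / \<sigma> k,
                    (\<sigma> 1)\<^sup>2 * s\<^sup>2 / (\<sigma> k * \<delta> k),
                    (\<sigma> 1 + sqrt (real n)) * (\<sigma> k + sqrt (real n)) * s / (\<sigma> k * \<delta> k)}"
        if sysM: "right_singular_system (A + E) \<sigma>' v'"
          and s: "s = sqrt (\<Sum>i\<in>{1..<k}. (sin (line_angle (v i) (v' i)))\<^sup>2)" for \<sigma>' v' s
      proof -
        have M: "A + E \<in> carrier_mat n n" using A E by simp
        have angle: "(sin (line_angle (v i) (v' i)))\<^sup>2 = 1 - (v i \<bullet> v' i)\<^sup>2" if "i \<in> {1..n}" for i
          using that vc vo[of i i] singular_vector_carrier[OF M sysM]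
            singular_vector_orthonormal[OF M sysM, of i i]
          by (intro sin_line_angle_squared) auto
        have s': "s = sqrt (\<Sum>i\<in>{1..<k}. 1 - (v i \<bullet> v' i)\<^sup>2)"
          unfolding s using kn by (intro arg_cong[where f = sqrt] sum.cong refl angle) auto
        have s0: "0 \<le> s" unfolding s by (simp add: sum_nonneg)
        have main: "\<sigma> k * \<delta> k * (sin (line_angle (v k) (v' k)))\<^sup>2
            \<le> (\<sigma> 1)\<^sup>2 * s\<^sup>2 + 2 * (20 * sqrt (real n)) * \<sigma> 1 * s
              + 4 * (26 * sqrt (real r * ln (real n))) * \<sigma> k + 5 * (20 * sqrt (real n))\<^sup>2"
          if "2 * (26 * sqrt (real r * ln (real n))) \<le> \<sigma> k"
          unfolding dk(1) s' angle[of k, simplified, OF conjI[OF assms(3)[simplified] less_imp_le[OF kn]]]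
          by (rule singular_vector_perturbation[OF A E assms(3) kn sysA sysM])
            (use dk B T[unfolded J_def u_def] L0 that in auto)
        have "(sin (line_angle (v k) (v' k)))\<^sup>2 \<le> 1" by (simp add: abs_square_le_1)
        from perturbation_bound_as_max[OF dk(2) dk_le s0 \<sigma>nn[of 1] this _ L0 main] kn show ?thesis by simp
      qed
      show ?thesis unfolding Good_def E_def[symmetric] Let_def using concl by blast
    qed
    have "measure_pmf.prob P Bad1 \<le> 2 / real n"
      unfolding P_def Bad1_def by (rule bernoulli_operator_norm) (use n2 in simp)
    moreover have "measure_pmf.prob P Bad2 \<le> 2 / real n"
      unfolding P_def Bad2_def
      by (rule bernoulli_compression_norm[OF n2 J(1) card_J r1 uJ uo vJ voJ])
    moreover have "measure_pmf.prob P (Bad1 \<union> Bad2) \<le> measure_pmf.prob P Bad1 + measure_pmf.prob P Bad2"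
      by (rule measure_Un_le) auto
    ultimately have "measure_pmf.prob P (Bad1 \<union> Bad2) \<le> p n" by (simp add: p_def)
    moreover have "measure_pmf.prob P (- (Bad1 \<union> Bad2)) = 1 - measure_pmf.prob P (Bad1 \<union> Bad2)"
      using measure_pmf.prob_compl[of "Bad1 \<union> Bad2" P] by (simp add: Compl_eq_Diff_UNIV)
    moreover have "measure_pmf.prob P (- (Bad1 \<union> Bad2)) \<le> measure_pmf.prob P (Matrix.mat n n -` Good)"
      by (rule measure_pmf.finite_measure_mono) (use good in auto)
    ultimately have "1 - p n \<le> measure_pmf.prob P (Matrix.mat n n -` Good)" by linarith
    then have "measure_pmf.prob (bernoulli_matrix_pmf n) Good \<ge> 1 - p n"
      unfolding bernoulli_matrix_pmf_def P_def by simp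
    then show "measure_pmf.prob (bernoulli_matrix_pmf n) ?Good \<ge> 1 - p n"
      unfolding Good_def .
  qed
qed

end
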